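(* Assume the spectral gap, removable singularity, quadratic degeneracy, $a$-regularity and $b$-regularity conditions stated in the context. For $f\in H^*$, $\theta\in\Theta$ and $0<\varepsilon<1$ let $u_{\varepsilon,\theta}\in H$ be the solution of $$\varepsilon^{-2}a_\theta(u_{\varepsilon,\theta},\tilde u)+b_\theta(u_{\varepsilon,\theta},\tilde u)=\langle f,\tilde u\rangle\qquad\forall \tilde u\in H.$$ Then there exists a unique $v+z\in V_\star\dot+Z$ ($v\in V_\star$, $z\in Z$) such that $$a^{\rm h}_{\theta/\varepsilon}(z,\tilde z)+b_0(v+z,\tilde v+\tilde z)=\langle f,\mathcal E_\theta\tilde v+\tilde z\rangle\qquad\forall\,\tilde v+\tilde z\in V_\star\dot+Z,$$ and there exist constants $C_9$ and $C_{10}$, independent of $\varepsilon$, $\theta$ and $f$, such that $$\varepsilon^{-2}a_\theta\big[u_{\varepsilon,\theta}-(\mathcal E_\theta v+(I+N_\theta)z)\big]+b_\theta\big[u_{\varepsilon,\theta}-(\mathcal E_\theta v+(I+N_\theta)z)\big]\le C_9\,\varepsilon^2\|f\|_{*\theta}^2,$$ $$b_\theta\big[u_{\varepsilon,\theta}-(\mathcal E_\theta v+z)\big]\le C_{10}\,\varepsilon^2\|f\|_{*\theta}^2 .$$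
   Context: $H$ is a separable complex Hilbert space, $n\ge 1$, $\Theta\subset\mathbb R^n$ is compact and connected with $0$ an interior point, and for each $\theta\in\Theta$, $a_\theta$ and $b_\theta$ are non-negative sesquilinear forms on $H\times H$. For a sesquilinear form $\mathfrak b$ write $\mathfrak b[u]:=\mathfrak b(u,u)$. Standing assumptions: for each $\theta$, $(u,\tilde u)_\theta:=a_\theta(u,\tilde u)+b_\theta(u,\tilde u)$ is an inner product on $H$ equivalent to the original one, with norm $\|\cdot\|_\theta$; there is $K>0$ with $\|u\|_{\theta_1}\le K\|u\|_{\theta_2}$ for all $u\in H$, $\theta_1,\theta_2\in\Theta$; there is $L_a>0$ with $|a_{\theta_1}(u,\tilde u)-a_{\theta_2}(u,\tilde u)|\le L_a|\theta_1-\theta_2|\,\|u\|_{\theta_1}\|\tilde u\|_{\theta_1}$ for all $u,\tilde u\in H$, $\theta_1,\theta_2\in\Theta$. $H^*$ is the space of antilinear continuous functionals on $H$, and $\|f\|_{*\theta}:=\sup_{u\ne0}|\langle f,u\rangle|/\|u\|_\theta$. $V_\theta:=\{v\in H: a_\theta[v]=0\}$ (a closed subspace), $W_\theta:=\{w\in H:(w,v)_\theta=0\ \forall v\in V_\theta\}$. Spectral gap condition: for every $\theta\in\Theta$ there is $\nu_\theta>0$ with $a_\theta[w]\ge\nu_\theta\|w\|_\theta^2$ for all $w\in W_\theta$. Removable singularity condition: there are a closed subspace $V_\star\subset H$ and $L_\star\ge0$ such that, with $V^\star_\theta:=V_\theta$ for $\theta\ne0$ and $V^\star_0:=V_\star$,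 one has $\inf_{v_2\in V^\star_{\theta_2}}\|v_1-v_2\|_{\theta_2}\le L_\star|\theta_1-\theta_2|\,\|v_1\|_{\theta_1}$ for all $v_1\in V^\star_{\theta_1}$, $\theta_1,\theta_2\in\Theta$. (Then $V_\star\subset V_0$.) $Z$ is a fixed closed subspace of $V_0$ with $V_0=V_\star\dot+Z$ (direct sum) and, for some $0\le K_Z<1$, $|(v_\star,z)_0|\le K_Z\|v_\star\|_0\|z\|_0$ for all $v_\star\in V_\star$, $z\in Z$. Quadratic degeneracy: there is $\gamma>0$ with $a_\theta[w]\ge\gamma|\theta|^2\|w\|_\theta^2$ for all $w\in W_\theta$, $\theta\in\Theta$. $a$-regularity: there exist sesquilinear maps $a_0':V_0\times H\to\mathbb C^n$, $a_0'':V_0\times V_0\to\mathbb C^{n\times n}$ and constants $K_{a'},K_{a''}\ge0$ with $|a_\theta(v,u)-a_0'(v,u)\cdot\theta|\le K_{a'}|\theta|^2\|v\|_0\|u\|_0$ for all $v\in V_0,u\in H,\theta\in\Theta$, and $|a_\theta(v,\tilde v)-a_0''(v,\tilde v)\theta\cdot\theta|\le K_{a''}|\theta|^3\|v\|_0\|\tilde v\|_0$ for all $v,\tilde v\in V_0$, $\theta\in\Theta$. $b$-regularity: there is $L_b\ge0$ with $|b_\theta(v,\tilde v)-b_0(v,\tilde v)|\le L_b|\theta|\,\|v\|_0\|\tilde v\|_\theta$ for all $v,\tilde v\in V_0$, $\theta\in\Theta$. Corrector and homogenised form: for $\theta\in\mathbb R^n$, $N_\theta:V_0\to W_0$ is the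 linear map such that $N_\theta v$ is the unique solution in $W_0$ of $a_0(N_\theta v,\tilde w_0)=-a_0'(v,\tilde w_0)\cdot\theta$ for all $\tilde w_0\in W_0$; and $a^{\rm h}_\theta(v,\tilde v):=a_0''(v,\tilde v)\theta\cdot\theta-a_0(N_\theta v,N_\theta\tilde v)$ for $v,\tilde v\in V_0$, $\theta\in\mathbb R^n$. Transfer operators: $\mathcal E_\theta:V_\star\to V_\theta^\star$, $\theta\in\Theta$, are fixed linear bijections satisfying $b_\theta(\mathcal E_\theta v,\mathcal E_\theta\tilde v)=b_0(v,\tilde v)$ for all $v,\tilde v\in V_\star$ and $|b_\theta(\mathcal E_\theta v,z)-b_0(v,z)|\le K_b|\theta|\,\|v\|_0\|z\|_0$ for all $v\in V_\star,z\in Z$, with a constant $K_b\ge0$ independent of $\theta$ (such $\mathcal E_\theta$ exist under the standing assumptions, the connectedness of $\Theta$, the removable singularity condition and the $b$-regularity condition). *)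

theory Defs
  imports "HOL-Analysis.Analysis"
begin

section \<open>Complex Hilbert spaces\<close>

class complex_vector = real_vector +
  fixes scaleC :: "complex \<Rightarrow> 'a \<Rightarrow> 'a" (infixr "*\<^sub>C" 75)
  assumes scaleC_add_right: "c *\<^sub>C (x + y) = c *\<^sub>C x + c *\<^sub>C y"
    and scaleC_add_left: "(c + d) *\<^sub>C x = c *\<^sub>C x + d *\<^sub>C x"
    and scaleC_scaleC: "c *\<^sub>C (d *\<^sub>C x) = (c * d) *\<^sub>C x"
    and scaleC_one: "1 *\<^sub>C x = x"
    and scaleR_scaleC: "r *\<^sub>R x = complex_of_real r *\<^sub>C x"

text \<open>The inner product is linear in its first and antilinear in its second argument.\<close>

class complex_inner = complex_vector + real_normed_vector +
  fixes cinner :: "'a \<Rightarrow> 'a \<Rightarrow> complex"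
  assumes cinner_commute: "cinner x y = cnj (cinner y x)"
    and cinner_add_left: "cinner (x + y) z = cinner x z + cinner y z"
    and cinner_scaleC_left: "cinner (c *\<^sub>C x) y = c * cinner x y"
    and cinner_ge_zero: "0 \<le> Re (cinner x x)"
    and cinner_eq_zero_iff: "cinner x x = 0 \<longleftrightarrow> x = 0"
    and norm_eq_sqrt_cinner: "norm x = sqrt (Re (cinner x x))"

class chilbert_space = complex_inner + complete_space

definition csubspace :: "'a::complex_vector set \<Rightarrow> bool" where
  "csubspace S \<longleftrightarrow> 0 \<in> S \<and> (\<forall>x\<in>S. \<forall>y\<in>S. x + y \<in> S) \<and> (\<forall>c. \<forall>x\<in>S. c *\<^sub>C x \<in> S)"

definition clinear_on :: "'a::complex_vector set \<Rightarrow> ('a \<Rightarrow> 'a) \<Rightarrow> bool" where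
  "clinear_on S T \<longleftrightarrow>
     (\<forall>x\<in>S. \<forall>y\<in>S. T (x + y) = T x + T y) \<and> (\<forall>c. \<forall>x\<in>S. T (c *\<^sub>C x) = c *\<^sub>C T x)"

definition antidual :: "('h::chilbert_space \<Rightarrow> complex) \<Rightarrow> bool" where
  "antidual f \<longleftrightarrow> (\<forall>u v. f (u + v) = f u + f v) \<and> (\<forall>c u. f (c *\<^sub>C u) = cnj c * f u)
     \<and> continuous_on UNIV f"

definition direct_sum :: "'a::complex_vector set \<Rightarrow> 'a set \<Rightarrow> 'a set \<Rightarrow> bool" where
  "direct_sum X A B \<longleftrightarrow> X = {x + y |x y. x \<in> A \<and> y \<in> B} \<and> A \<inter> B = {0}"


section \<open>Sesquilinear forms\<close>

type_synonym 'h form = "'h \<Rightarrow> 'h \<Rightarrow> complex"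

definition sesquilinear_on :: "'h::complex_vector set \<Rightarrow> 'h set \<Rightarrow> 'h form \<Rightarrow> bool" where
  "sesquilinear_on A B g \<longleftrightarrow>
     (\<forall>u\<in>A. \<forall>v\<in>A. \<forall>w\<in>B. g (u + v) w = g u w + g v w) \<and>
     (\<forall>c. \<forall>u\<in>A. \<forall>w\<in>B. g (c *\<^sub>C u) w = c * g u w) \<and>
     (\<forall>u\<in>A. \<forall>v\<in>B. \<forall>w\<in>B. g u (v + w) = g u v + g u w) \<and>
     (\<forall>c. \<forall>u\<in>A. \<forall>w\<in>B. g u (c *\<^sub>C w) = cnj c * g u w)"

definition nonneg_form :: "'h::complex_vector form \<Rightarrow> bool" where
  "nonneg_form g \<longleftrightarrow>
     sesquilinear_on UNIV UNIV g \<and> (\<forall>u. g u u \<in> \<real> \<and> 0 \<le> Re (g u u))"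

text \<open>The value g[u] = g(u,u). It is only used for forms that are real on the diagonal,
  so taking the real part loses nothing.\<close>

definition quad :: "'h form \<Rightarrow> 'h \<Rightarrow> real" where
  "quad g u = Re (g u u)"

definition inner_product :: "'h::complex_vector form \<Rightarrow> bool" where
  "inner_product g \<longleftrightarrow> sesquilinear_on UNIV UNIV g \<and> (\<forall>u v. g u v = cnj (g v u)) \<and>
     (\<forall>u. 0 \<le> quad g u) \<and> (\<forall>u. g u u = 0 \<longleftrightarrow> u = 0)"

text \<open>Equivalence with the original inner product, i.e. equivalence of the induced norms.\<close>

definition equivalent_inner :: "'h::chilbert_space form \<Rightarrow> bool" where
  "equivalent_inner g \<longleftrightarrow>
     (\<exists>c>0. \<exists>C>0. \<forall>u. c * norm u \<le> sqrt (quad g u) \<and> sqrt (quad g u) \<le> C * norm u)"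


section \<open>Parameter-dependent forms\<close>

text \<open>Families indexed by the parameter are total functions on the whole of R^n; only their
  values for parameters in the set \<open>\<Theta>\<close> are constrained and used.\<close>

type_synonym ('n, 'h) forms = "real ^ 'n \<Rightarrow> 'h form"

definition ip :: "('n, 'h) forms \<Rightarrow> ('n, 'h) forms \<Rightarrow> ('n, 'h) forms" where
  "ip a b \<theta> u v = a \<theta> u v + b \<theta> u v"

definition nrm :: "('n, 'h) forms \<Rightarrow> ('n, 'h) forms \<Rightarrow> real ^ 'n \<Rightarrow> 'h \<Rightarrow> real" where
  "nrm a b \<theta> u = sqrt (quad (ip a b \<theta>) u)"

text \<open>If the space is trivial, this is the supremum of the empty set, an unspecified real
  number.\<close>

definition dual_nrm ::
  "('n, 'h) forms \<Rightarrow> ('n, 'h) forms \<Rightarrow> real ^ 'n \<Rightarrow> ('h::chilbert_space \<Rightarrow> complex) \<Rightarrow> real" where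
  "dual_nrm a b \<theta> f = (SUP u\<in>UNIV - {0}. norm (f u) / nrm a b \<theta> u)"

definition standing ::
  "(real ^ 'n) set \<Rightarrow> ('n::finite, 'h::chilbert_space) forms \<Rightarrow> ('n, 'h) forms \<Rightarrow> bool" where
  "standing \<Theta> a b \<longleftrightarrow>
     compact \<Theta> \<and> connected \<Theta> \<and> 0 \<in> interior \<Theta> \<and>
     (\<forall>\<theta>\<in>\<Theta>. nonneg_form (a \<theta>) \<and> nonneg_form (b \<theta>)) \<and>
     (\<forall>\<theta>\<in>\<Theta>. inner_product (ip a b \<theta>) \<and> equivalent_inner (ip a b \<theta>)) \<and>
     (\<exists>K>0. \<forall>u. \<forall>\<theta>1\<in>\<Theta>. \<forall>\<theta>2\<in>\<Theta>. nrm a b \<theta>1 u \<le> K * nrm a b \<theta>2 u) \<and>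
     (\<exists>L>0. \<forall>u v. \<forall>\<theta>1\<in>\<Theta>. \<forall>\<theta>2\<in>\<Theta>.
        norm (a \<theta>1 u v - a \<theta>2 u v) \<le> L * norm (\<theta>1 - \<theta>2) * nrm a b \<theta>1 u * nrm a b \<theta>1 v)"

definition V :: "('n, 'h) forms \<Rightarrow> real ^ 'n \<Rightarrow> 'h set" where
  "V a \<theta> = {v. a \<theta> v v = 0}"

definition W :: "('n, 'h) forms \<Rightarrow> ('n, 'h) forms \<Rightarrow> real ^ 'n \<Rightarrow> 'h set" where
  "W a b \<theta> = {w. \<forall>v\<in>V a \<theta>. ip a b \<theta> w v = 0}"

definition Vstar :: "('n::finite, 'h) forms \<Rightarrow> 'h set \<Rightarrow> real ^ 'n \<Rightarrow> 'h set" where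
  "Vstar a Vs \<theta> = (if \<theta> = 0 then Vs else V a \<theta>)"

definition spectral_gap ::
  "(real ^ 'n) set \<Rightarrow> ('n, 'h) forms \<Rightarrow> ('n, 'h) forms \<Rightarrow> bool" where
  "spectral_gap \<Theta> a b \<longleftrightarrow>
     (\<forall>\<theta>\<in>\<Theta>. \<exists>\<nu>>0. \<forall>w\<in>W a b \<theta>. \<nu> * (nrm a b \<theta> w)\<^sup>2 \<le> quad (a \<theta>) w)"

definition removable_singularity ::
  "(real ^ 'n) set \<Rightarrow> ('n::finite, 'h::chilbert_space) forms \<Rightarrow> ('n, 'h) forms \<Rightarrow> 'h set \<Rightarrow> bool" where
  "removable_singularity \<Theta> a b Vs \<longleftrightarrow> csubspace Vs \<and> closed Vs \<and>
     (\<exists>L\<ge>0. \<forall>\<theta>1\<in>\<Theta>. \<forall>\<theta>2\<in>\<Theta>. \<forall>v1\<in>Vstar a Vs \<theta>1.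
        (INF v2\<in>Vstar a Vs \<theta>2. nrm a b \<theta>2 (v1 - v2)) \<le> L * norm (\<theta>1 - \<theta>2) * nrm a b \<theta>1 v1)"

definition complement ::
  "('n::finite, 'h::chilbert_space) forms \<Rightarrow> ('n, 'h) forms \<Rightarrow> 'h set \<Rightarrow> 'h set \<Rightarrow> bool" where
  "complement a b Vs Z \<longleftrightarrow> csubspace Z \<and> closed Z \<and> Z \<subseteq> V a 0 \<and> direct_sum (V a 0) Vs Z \<and>
     (\<exists>K\<ge>0. K < 1 \<and> (\<forall>v\<in>Vs. \<forall>z\<in>Z. norm (ip a b 0 v z) \<le> K * nrm a b 0 v * nrm a b 0 z))"

definition quadratic_degeneracy ::
  "(real ^ 'n) set \<Rightarrow> ('n::finite, 'h) forms \<Rightarrow> ('n, 'h) forms \<Rightarrow> bool" where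
  "quadratic_degeneracy \<Theta> a b \<longleftrightarrow>
     (\<exists>\<gamma>>0. \<forall>\<theta>\<in>\<Theta>. \<forall>w\<in>W a b \<theta>. \<gamma> * (norm \<theta>)\<^sup>2 * (nrm a b \<theta> w)\<^sup>2 \<le> quad (a \<theta>) w)"

text \<open>\<open>cdot x \<theta>\<close> and \<open>cquad A \<theta>\<close> are the (bilinear) products \<open>x \<cdot> \<theta>\<close> and \<open>A\<theta> \<cdot> \<theta>\<close> of complex data
  with a real vector.\<close>

definition cdot :: "complex ^ 'n::finite \<Rightarrow> real ^ 'n \<Rightarrow> complex" where
  "cdot x \<theta> = (\<Sum>i\<in>UNIV. x $ i * complex_of_real (\<theta> $ i))"

definition cquad :: "complex ^ 'n ^ 'n::finite \<Rightarrow> real ^ 'n \<Rightarrow> complex" where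
  "cquad A \<theta> = cdot (A *v (\<chi> j. complex_of_real (\<theta> $ j))) \<theta>"

definition a_regularity ::
  "(real ^ 'n) set \<Rightarrow> ('n::finite, 'h::chilbert_space) forms \<Rightarrow> ('n, 'h) forms \<Rightarrow>
   ('h \<Rightarrow> 'h \<Rightarrow> complex ^ 'n) \<Rightarrow> ('h \<Rightarrow> 'h \<Rightarrow> complex ^ 'n ^ 'n) \<Rightarrow> bool" where
  "a_regularity \<Theta> a b a' a'' \<longleftrightarrow>
     (\<forall>i. sesquilinear_on (V a 0) UNIV (\<lambda>v u. a' v u $ i)) \<and>
     (\<forall>i j. sesquilinear_on (V a 0) (V a 0) (\<lambda>v u. a'' v u $ i $ j)) \<and>
     (\<exists>K\<ge>0. \<forall>v\<in>V a 0. \<forall>u. \<forall>\<theta>\<in>\<Theta>.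
        norm (a \<theta> v u - cdot (a' v u) \<theta>) \<le> K * (norm \<theta>)\<^sup>2 * nrm a b 0 v * nrm a b 0 u) \<and>
     (\<exists>K\<ge>0. \<forall>v\<in>V a 0. \<forall>w\<in>V a 0. \<forall>\<theta>\<in>\<Theta>.
        norm (a \<theta> v w - cquad (a'' v w) \<theta>) \<le> K * (norm \<theta>) ^ 3 * nrm a b 0 v * nrm a b 0 w)"

definition b_regularity ::
  "(real ^ 'n) set \<Rightarrow> ('n::finite, 'h) forms \<Rightarrow> ('n, 'h) forms \<Rightarrow> bool" where
  "b_regularity \<Theta> a b \<longleftrightarrow>
     (\<exists>L\<ge>0. \<forall>v\<in>V a 0. \<forall>w\<in>V a 0. \<forall>\<theta>\<in>\<Theta>.
        norm (b \<theta> v w - b 0 v w) \<le> L * norm \<theta> * nrm a b 0 v * nrm a b \<theta> w)"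

definition corrector ::
  "('n::finite, 'h) forms \<Rightarrow> ('n, 'h) forms \<Rightarrow> ('h \<Rightarrow> 'h \<Rightarrow> complex ^ 'n) \<Rightarrow>
   real ^ 'n \<Rightarrow> 'h \<Rightarrow> 'h" where
  "corrector a b a' \<theta> v =
     (THE w. w \<in> W a b 0 \<and> (\<forall>w'\<in>W a b 0. a 0 w w' = - cdot (a' v w') \<theta>))"

definition hom_form ::
  "('n::finite, 'h) forms \<Rightarrow> ('n, 'h) forms \<Rightarrow> ('h \<Rightarrow> 'h \<Rightarrow> complex ^ 'n) \<Rightarrow>
   ('h \<Rightarrow> 'h \<Rightarrow> complex ^ 'n ^ 'n) \<Rightarrow> ('n, 'h) forms" where
  "hom_form a b a' a'' \<theta> v w =
     cquad (a'' v w) \<theta> - a 0 (corrector a b a' \<theta> v) (corrector a b a' \<theta> w)"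

definition transfer_ops ::
  "(real ^ 'n) set \<Rightarrow> ('n::finite, 'h::chilbert_space) forms \<Rightarrow> ('n, 'h) forms \<Rightarrow> 'h set \<Rightarrow> 'h set \<Rightarrow>
   (real ^ 'n \<Rightarrow> 'h \<Rightarrow> 'h) \<Rightarrow> bool" where
  "transfer_ops \<Theta> a b Vs Z E \<longleftrightarrow>
     (\<forall>\<theta>\<in>\<Theta>. clinear_on Vs (E \<theta>) \<and> bij_betw (E \<theta>) Vs (Vstar a Vs \<theta>)) \<and>
     (\<forall>\<theta>\<in>\<Theta>. \<forall>v\<in>Vs. \<forall>w\<in>Vs. b \<theta> (E \<theta> v) (E \<theta> w) = b 0 v w) \<and>
     (\<exists>K\<ge>0. \<forall>\<theta>\<in>\<Theta>. \<forall>v\<in>Vs. \<forall>z\<in>Z.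
        norm (b \<theta> (E \<theta> v) z - b 0 v z) \<le> K * norm \<theta> * nrm a b 0 v * nrm a b 0 z)"

definition solves_full ::
  "('n, 'h) forms \<Rightarrow> ('n, 'h) forms \<Rightarrow> ('h \<Rightarrow> complex) \<Rightarrow> real ^ 'n \<Rightarrow> real \<Rightarrow> 'h \<Rightarrow> bool" where
  "solves_full a b f \<theta> \<epsilon> u \<longleftrightarrow>
     (\<forall>w. complex_of_real (1 / \<epsilon>\<^sup>2) * a \<theta> u w + b \<theta> u w = f w)"

definition solves_hom ::
  "('n::finite, 'h::chilbert_space) forms \<Rightarrow> ('n, 'h) forms \<Rightarrow> ('h \<Rightarrow> 'h \<Rightarrow> complex ^ 'n) \<Rightarrow>
   ('h \<Rightarrow> 'h \<Rightarrow> complex ^ 'n ^ 'n) \<Rightarrow> 'h set \<Rightarrow> 'h set \<Rightarrow> (real ^ 'n \<Rightarrow> 'h \<Rightarrow> 'h) \<Rightarrow>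
   ('h \<Rightarrow> complex) \<Rightarrow> real ^ 'n \<Rightarrow> real \<Rightarrow> 'h \<Rightarrow> 'h \<Rightarrow> bool" where
  "solves_hom a b a' a'' Vs Z E f \<theta> \<epsilon> v z \<longleftrightarrow> v \<in> Vs \<and> z \<in> Z \<and>
     (\<forall>v'\<in>Vs. \<forall>z'\<in>Z.
        hom_form a b a' a'' ((1 / \<epsilon>) *\<^sub>R \<theta>) z z' + b 0 (v + z) (v' + z') = f (E \<theta> v' + z'))"

end

theory Submission imports Defs begin

text \<open>
  Write \<open>N\<close> for the norm at \<open>\<theta> = 0\<close>. Since the part of \<open>a \<theta> (v, u)\<close> linear in \<open>\<theta>\<close> vanishes on
  \<open>V a 0\<close>, the corrector cancels it altogether: \<open>a \<theta> (z + corr \<theta> z, u)\<close> is \<open>O(|\<theta>|\<^sup>2)\<close> for every \<open>u\<close>,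
  and agrees with the homogenised form up to \<open>O(|\<theta>|\<^sup>3)\<close> for \<open>u\<close> in \<open>V a 0\<close>. The latter, the quadratic
  degeneracy and the closeness of \<open>V a \<theta>\<close> to \<open>Vs\<close> give coercivity of the homogenised form on \<open>Z\<close> for
  small \<open>\<theta>\<close>, hence for all \<open>\<theta>\<close> by homogeneity; so the homogenised problem is well posed, with \<open>N v\<close>,
  \<open>N z\<close>, \<open>|\<theta>| N z / \<epsilon>\<close> and \<open>|\<theta>|\<^sup>2 N z / \<epsilon>\<^sup>2\<close> bounded by the dual norm of \<open>f\<close>. On the other side every
  \<open>w\<close> splits as \<open>E \<theta> v' + z' + r\<close> with \<open>|\<theta>| N z'\<close> and \<open>N r\<close> bounded by \<open>sqrt (a \<theta> [w])\<close>. Inserting both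
  into the residual of the approximation, tested with the error itself, gives the estimates with
  constants uniform in \<open>\<theta>\<close> and \<open>\<epsilon>\<close>.
\<close>

section \<open>Sesquilinear forms on a Hilbert space\<close>

text \<open>The obstacle is that the kernel of \<open>a \<theta>\<close> jumps at \<theta> = 0:
  there it is the sum of \<open>Vs\<close> and \<open>Z\<close>, while the kernels nearby are close
  to \<open>Vs\<close> alone, and on \<open>Z\<close> the form is only of size |\<theta>|^2. The
  form therefore controls the component \<open>z'\<close> of a test vector through |\<theta>| N z'
  but not through N z' itself, so every residual term containing \<open>z'\<close> has to bring its
  own factor |\<theta>|. For \<open>b\<close> the regularity of the form and of \<open>E\<close>
  supplies it; for \<open>a\<close> the homogenised equation removes the quadratic part and leaves
  |\<theta>|^3 / \<epsilon>^2, which is shared out as (|\<theta>|^2 N z / \<epsilon>^2) (|\<theta>|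
  N z'). The rate comes from the weight \<epsilon>^(-2). If A is the energy of the error e, then
  sqrt (a[e]) is at most \<epsilon> sqrt A, so a residual bounded by a multiple of F (sqrt (a[e]) +
  \<epsilon> |e|) forces sqrt A = O(\<epsilon> F).\<close>

lemma csubspace_add: "csubspace S \<Longrightarrow> x \<in> S \<Longrightarrow> y \<in> S \<Longrightarrow> x + y \<in> S"
  and csubspace_scaleC: "csubspace S \<Longrightarrow> x \<in> S \<Longrightarrow> c *\<^sub>C x \<in> S"
  and csubspace_zero: "csubspace S \<Longrightarrow> 0 \<in> S"
  by (auto simp: csubspace_def)

lemma csubspace_scaleR: "csubspace S \<Longrightarrow> x \<in> S \<Longrightarrow> t *\<^sub>R x \<in> S"
  by (simp add: csubspace_scaleC scaleR_scaleC)

lemma minus_eq_scaleC: "- (x::'a::complex_vector) = (-1) *\<^sub>C x"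
  using scaleR_scaleC[of "-1" x] by simp

lemma csubspace_uminus: "csubspace S \<Longrightarrow> x \<in> S \<Longrightarrow> - x \<in> S"
  by (simp add: minus_eq_scaleC csubspace_scaleC)

lemma csubspace_diff: "csubspace S \<Longrightarrow> x \<in> S \<Longrightarrow> y \<in> S \<Longrightarrow> x - y \<in> S"
  by (metis add_uminus_conv_diff csubspace_add csubspace_uminus)

lemmas csubspace_closed_ops =
  csubspace_add csubspace_scaleC csubspace_scaleR csubspace_uminus csubspace_diff csubspace_zero

lemma csubspace_UNIV: "csubspace UNIV"
  by (simp add: csubspace_def)

lemma scaleC_diff_right: "c *\<^sub>C (x - y) = c *\<^sub>C x - c *\<^sub>C (y::'a::complex_vector)"
  using scaleC_add_right[of c "x - y" y] by (simp add: algebra_simps)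

lemma
  assumes "sesquilinear_on S T g" "csubspace S" "csubspace T"
  shows sesq_add_left: "u \<in> S \<Longrightarrow> v \<in> S \<Longrightarrow> w \<in> T \<Longrightarrow> g (u + v) w = g u w + g v w"
    and sesq_add_right: "u \<in> S \<Longrightarrow> v \<in> T \<Longrightarrow> w \<in> T \<Longrightarrow> g u (v + w) = g u v + g u w"
    and sesq_scaleC_left: "u \<in> S \<Longrightarrow> w \<in> T \<Longrightarrow> g (c *\<^sub>C u) w = c * g u w"
    and sesq_scaleC_right: "u \<in> S \<Longrightarrow> w \<in> T \<Longrightarrow> g u (c *\<^sub>C w) = cnj c * g u w"
    and sesq_scaleR_left: "u \<in> S \<Longrightarrow> w \<in> T \<Longrightarrow> g (t *\<^sub>R u) w = of_real t * g u w"
    and sesq_scaleR_right: "u \<in> S \<Longrightarrow> w \<in> T \<Longrightarrow> g u (t *\<^sub>R w) = of_real t * g u w"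
    and sesq_uminus_left: "u \<in> S \<Longrightarrow> w \<in> T \<Longrightarrow> g (- u) w = - g u w"
    and sesq_uminus_right: "u \<in> S \<Longrightarrow> w \<in> T \<Longrightarrow> g u (- w) = - g u w"
    and sesq_diff_left: "u \<in> S \<Longrightarrow> v \<in> S \<Longrightarrow> w \<in> T \<Longrightarrow> g (u - v) w = g u w - g v w"
    and sesq_diff_right: "u \<in> S \<Longrightarrow> v \<in> T \<Longrightarrow> w \<in> T \<Longrightarrow> g u (v - w) = g u v - g u w"
    and sesq_zero_left: "w \<in> T \<Longrightarrow> g 0 w = 0"
    and sesq_zero_right: "u \<in> S \<Longrightarrow> g u 0 = 0"
proof -
  note s = assms(1)[unfolded sesquilinear_on_def]
  show a1: "g (u + v) w = g u w + g v w" if "u \<in> S" "v \<in> S" "w \<in> T" for u v w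
    using s that by blast
  show a2: "g u (v + w) = g u v + g u w" if "u \<in> S" "v \<in> T" "w \<in> T" for u v w
    using s that by blast
  show c1: "g (c *\<^sub>C u) w = c * g u w" if "u \<in> S" "w \<in> T" for c u w
    using s that by blast
  show c2: "g u (c *\<^sub>C w) = cnj c * g u w" if "u \<in> S" "w \<in> T" for c u w
    using s that by blast
  show "g (t *\<^sub>R u) w = of_real t * g u w" "g u (t *\<^sub>R w) = of_real t * g u w"
    if "u \<in> S" "w \<in> T" for t u w
    using that by (simp_all add: c1 c2 scaleR_scaleC)
  show m1: "g (- u) w = - g u w" if "u \<in> S" "w \<in> T" for u w
    using that by (simp add: c1 minus_eq_scaleC)
  show m2: "g u (- w) = - g u w" if "u \<in> S" "w \<in> T" for u w
    using that by (simp add: c2 minus_eq_scaleC)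
  show d1: "g (u - v) w = g u w - g v w" if "u \<in> S" "v \<in> S" "w \<in> T" for u v w
    using that a1[of u "-v" w] m1[of v w] csubspace_uminus[OF assms(2), of v] by simp
  show d2: "g u (v - w) = g u v - g u w" if "u \<in> S" "v \<in> T" "w \<in> T" for u v w
    using that a2[of u v "-w"] m2[of u w] csubspace_uminus[OF assms(3), of w] by simp
  show "g 0 w = 0" if "w \<in> T" for w
    using d1[of 0 0 w] that csubspace_zero[OF assms(2)] by simp
  show "g u 0 = 0" if "u \<in> S" for u
    using d2[of u 0 0] that csubspace_zero[OF assms(3)] by simp
qed

lemmas sesq_simps = sesq_add_left sesq_add_right sesq_scaleC_left sesq_scaleC_right
  sesq_scaleR_left sesq_scaleR_right sesq_uminus_left sesq_uminus_right
  sesq_diff_left sesq_diff_right sesq_zero_left sesq_zero_right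

lemma nonneg_form_sesq: "nonneg_form g \<Longrightarrow> sesquilinear_on UNIV UNIV g"
  by (simp add: nonneg_form_def)

lemma
  assumes "nonneg_form g"
  shows form_add_left: "g (u + v) w = g u w + g v w"
    and form_add_right: "g u (v + w) = g u v + g u w"
    and form_scaleC_left: "g (c *\<^sub>C u) w = c * g u w"
    and form_scaleC_right: "g u (c *\<^sub>C w) = cnj c * g u w"
    and form_scaleR_left: "g (t *\<^sub>R u) w = of_real t * g u w"
    and form_scaleR_right: "g u (t *\<^sub>R w) = of_real t * g u w"
    and form_uminus_left: "g (- u) w = - g u w"
    and form_uminus_right: "g u (- w) = - g u w"
    and form_diff_left: "g (u - v) w = g u w - g v w"
    and form_diff_right: "g u (v - w) = g u v - g u w"
    and form_zero_left: "g 0 w = 0"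
    and form_zero_right: "g u 0 = 0"
  using sesq_simps[OF nonneg_form_sesq[OF assms] csubspace_UNIV csubspace_UNIV] by simp_all

lemmas form_simps = form_add_left form_add_right form_scaleC_left form_scaleC_right
  form_scaleR_left form_scaleR_right form_uminus_left form_uminus_right
  form_diff_left form_diff_right form_zero_left form_zero_right

lemma form_diag:
  assumes "nonneg_form g"
  shows "g u u = of_real (quad g u)" "0 \<le> quad g u"
  using assms unfolding nonneg_form_def quad_def by (auto simp: complex_is_Real_iff complex_eq_iff)

text \<open>Polarisation: the diagonal is real at u + v, which compares the imaginary parts of
  \<open>g u v\<close> and \<open>g v u\<close>, and at u + i v, which compares their real
  parts.\<close>

lemma form_herm:
  assumes "nonneg_form g"
  shows "g u v = cnj (g v u)"
proof -
  have "Im (g w w) = 0" for w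
    using form_diag(1)[OF assms, of w] by (metis Im_complex_of_real)
  from this[of u] this[of v] this[of "u + v"] this[of "u + \<i> *\<^sub>C v"]
  show ?thesis
    by (simp add: form_simps[OF assms] complex_eq_iff)
qed

lemma form_quad_line:
  assumes "nonneg_form g"
  shows "quad g (u + c *\<^sub>C v) = quad g u + 2 * Re (cnj c * g u v) + (norm c)\<^sup>2 * quad g v"
proof -
  have "Re (c * g v u) = Re (cnj c * g u v)"
    using form_herm[OF assms, of v u] by simp
  moreover have "Re (c * (cnj c * g v v)) = (norm c)\<^sup>2 * quad g v"
    unfolding mult.assoc[symmetric] complex_mult_cnj
    by (simp add: quad_def cmod_power2)
  ultimately show ?thesis
    unfolding quad_def form_simps[OF assms] by (simp add: algebra_simps)
qed

section \<open>The seminorm of a non-negative form\<close>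

definition form_norm :: "'h form \<Rightarrow> 'h \<Rightarrow> real" where
  "form_norm g u = sqrt (quad g u)"

lemma form_norm_ge_zero: "nonneg_form g \<Longrightarrow> 0 \<le> form_norm g u"
  by (simp add: form_norm_def form_diag)

lemma form_norm_square: "nonneg_form g \<Longrightarrow> (form_norm g u)\<^sup>2 = quad g u"
  by (simp add: form_norm_def form_diag)

lemma form_cauchy_schwarz:
  assumes g: "nonneg_form g"
  shows "norm (g u v) \<le> form_norm g u * form_norm g v"
proof -
  have key: "0 \<le> quad g u - 2 * t * (norm (g u v))\<^sup>2 + t\<^sup>2 * (norm (g u v))\<^sup>2 * quad g v" for t :: real
  proof -
    \<comment> \<open>This multiple aligns the phase, so that the cross term is real and equals -t
      times the squared modulus of \<open>g u v\<close>.\<close>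
    let ?c = "- of_real t * g u v"
    have "cnj ?c * g u v = of_real (- t * (norm (g u v))\<^sup>2)"
      using complex_norm_square[of "g u v"] by (simp add: mult.commute)
    then have "Re (cnj ?c * g u v) = - t * (norm (g u v))\<^sup>2"
      by (metis Re_complex_of_real)
    moreover have "(norm ?c)\<^sup>2 = t\<^sup>2 * (norm (g u v))\<^sup>2"
      by (simp add: norm_mult power_mult_distrib)
    ultimately show ?thesis
      using form_quad_line[OF g, of u ?c v] form_diag(2)[OF g, of "u + ?c *\<^sub>C v"] by simp
  qed
  have "(norm (g u v))\<^sup>2 \<le> quad g u * quad g v"
  proof (cases "quad g v = 0")
    case True
    show ?thesis
    proof (rule ccontr)
      assume "\<not> ?thesis"
      then have pos: "(norm (g u v))\<^sup>2 > 0" using True by simp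
      \<comment> \<open>With \<open>quad g v = 0\<close> the expansion is affine in t, and this t
        brings it down to -1.\<close>
      have "0 \<le> quad g u - 2 * ((quad g u + 1) / (2 * (norm (g u v))\<^sup>2)) * (norm (g u v))\<^sup>2"
        using key[of "(quad g u + 1) / (2 * (norm (g u v))\<^sup>2)"] True by simp
      also have "\<dots> = - 1" using pos by (simp add: field_simps)
      finally show False by simp
    qed
  next
    case False
    then have pos: "quad g v > 0" using form_diag(2)[OF g, of v] by simp
    have "0 \<le> quad g u - (norm (g u v))\<^sup>2 / quad g v"
      using key[of "1 / quad g v"] pos by (simp add: power2_eq_square)
    then show ?thesis using pos by (simp add: field_simps)
  qed
  then have "(norm (g u v))\<^sup>2 \<le> (form_norm g u * form_norm g v)\<^sup>2"
    by (simp add: power_mult_distrib form_norm_square[OF g])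
  then show ?thesis
    by (rule power2_le_imp_le) (simp add: form_norm_ge_zero[OF g])
qed

lemma form_norm_triangle:
  assumes g: "nonneg_form g"
  shows "form_norm g (u + v) \<le> form_norm g u + form_norm g v"
proof -
  have "quad g (u + v) = quad g u + 2 * Re (g u v) + quad g v"
    using form_quad_line[OF g, of u 1 v] by (simp add: scaleC_one)
  also have "Re (g u v) \<le> form_norm g u * form_norm g v"
    using form_cauchy_schwarz[OF g, of u v] complex_Re_le_cmod[of "g u v"] by linarith
  finally have "(form_norm g (u + v))\<^sup>2 \<le> (form_norm g u + form_norm g v)\<^sup>2"
    by (simp add: form_norm_square[OF g] power2_sum)
  then show ?thesis
    by (rule power2_le_imp_le) (simp add: form_norm_ge_zero[OF g])
qed

lemma form_norm_uminus: "nonneg_form g \<Longrightarrow> form_norm g (- u) = form_norm g u"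
  by (simp add: form_norm_def quad_def form_simps)

lemma form_norm_triangle_diff:
  "nonneg_form g \<Longrightarrow> form_norm g (u - v) \<le> form_norm g u + form_norm g v"
  using form_norm_triangle[of g u "- v"] by (simp add: form_norm_uminus)

lemma form_norm_zero: "nonneg_form g \<Longrightarrow> form_norm g 0 = 0"
  by (simp add: form_norm_def quad_def form_zero_left)

lemma form_null_iff:
  assumes g: "nonneg_form g"
  shows "g v v = 0 \<longleftrightarrow> form_norm g v = 0"
  by (simp add: form_diag(1)[OF g] form_norm_def)

text \<open>Cauchy-Schwarz puts every isotropic vector into the kernel of the form. This is what
  makes \<open>V a \<theta>\<close>, given by a quadratic condition, a closed subspace.\<close>

lemma form_null:
  assumes g: "nonneg_form g" and "g v v = 0"
  shows "g v u = 0" "g u v = 0"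
  using form_cauchy_schwarz[OF g, of v u] form_cauchy_schwarz[OF g, of u v] assms(2)
  by (simp_all add: form_null_iff[OF g])

text \<open>Replaces the passage t \<rightarrow> 0 along a ray of parameters
  \<open>t *\<^sub>R \<theta>\<close>, by which coefficients of powers of \<theta> are
  compared.\<close>

lemma le_zero_if_le_linear:
  fixes x C :: real
  assumes "t0 > 0" and "\<And>t. 0 < t \<Longrightarrow> t \<le> t0 \<Longrightarrow> x \<le> C * t"
  shows "x \<le> 0"
proof (rule ccontr)
  assume x: "\<not> x \<le> 0"
  define t where "t = min t0 (x / (2 * (\<bar>C\<bar> + 1)))"
  have t: "0 < t" "t \<le> t0" "t \<le> x / (2 * (\<bar>C\<bar> + 1))"
    using x assms(1) by (auto simp: t_def)
  have "x \<le> C * t" using assms(2) t by blast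
  also have "\<dots> \<le> (\<bar>C\<bar> + 1) * t" using t by (intro mult_right_mono) auto
  also have "\<dots> \<le> (\<bar>C\<bar> + 1) * (x / (2 * (\<bar>C\<bar> + 1)))" using t by (intro mult_left_mono) auto
  also have "\<dots> = x / 2" by (simp add: field_simps)
  finally show False using x by simp
qed

text \<open>The solution is the limit of a minimising sequence of \<open>J u = B[u] - 2 Re (f u)\<close>; both the
  Cauchy property and the Euler equation are read off the expansion of \<open>J\<close> along a line.\<close>

theorem riesz_form:
  fixes B :: "'h::chilbert_space form"
  assumes S: "csubspace S" "closed S" and sesq: "sesquilinear_on S S B"
    and herm: "\<And>u v. u \<in> S \<Longrightarrow> v \<in> S \<Longrightarrow> B u v = cnj (B v u)"
    and c: "c > 0" "\<And>u. u \<in> S \<Longrightarrow> c * (norm u)\<^sup>2 \<le> Re (B u u)"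
    and C: "\<And>u v. u \<in> S \<Longrightarrow> v \<in> S \<Longrightarrow> norm (B u v) \<le> C * norm u * norm v"
    and f_add: "\<And>u v. u \<in> S \<Longrightarrow> v \<in> S \<Longrightarrow> f (u + v) = f u + f v"
    and f_scale: "\<And>c u. u \<in> S \<Longrightarrow> f (c *\<^sub>C u) = cnj c * f u"
    and M: "\<And>u. u \<in> S \<Longrightarrow> norm (f u) \<le> M * norm u"
  shows "\<exists>!u. u \<in> S \<and> (\<forall>w\<in>S. B u w = f w)"
proof -
  note bs = sesq_simps[OF sesq S(1) S(1)] and Sc = csubspace_closed_ops[OF S(1)]
  define J where "J u = Re (B u u) - 2 * Re (f u)" for u
  have J_line: "J (u + t *\<^sub>R w) = J u + 2 * t * Re (B u w - f w) + t\<^sup>2 * Re (B w w)"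
    if "u \<in> S" "w \<in> S" for u w t
    using that herm[of w u]
    by (simp add: J_def bs Sc f_add f_scale[of w "of_real t"] scaleR_scaleC[of t] algebra_simps
        power2_eq_square)
  have J_bound: "- (M\<^sup>2 / c) \<le> J u" if "u \<in> S" for u
  proof -
    have "Re (f u) \<le> M * norm u" using M[OF that] complex_Re_le_cmod[of "f u"] by linarith
    then have "c * (norm u)\<^sup>2 - 2 * (M * norm u) \<le> J u"
      using c(2)[OF that] unfolding J_def by linarith
    moreover have "c * (norm u - M / c)\<^sup>2 = c * (norm u)\<^sup>2 - 2 * (M * norm u) + M\<^sup>2 / c"
      using c(1) by (simp add: field_simps power2_eq_square)
    moreover have "0 \<le> c * (norm u - M / c)\<^sup>2" using c(1) by simp
    ultimately show ?thesis by linarith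
  qed
  define m where "m = Inf (J ` S)"
  have bdd: "bdd_below (J ` S)" using J_bound by (auto intro!: bdd_belowI)
  have m_le: "m \<le> J u" if "u \<in> S" for u unfolding m_def using bdd that by (auto intro: cInf_lower)
  have "\<exists>x\<in>S. J x < m + inverse (real (Suc n))" for n
    using cInf_lessD[of "J ` S" "m + inverse (real (Suc n))"] Sc(6) unfolding m_def by auto
  then obtain x where x: "\<And>n. x n \<in> S" "\<And>n. J (x n) < m + inverse (real (Suc n))"
    by metis
  \<comment> \<open>The midpoint has value at least m, and J there is the mean of the two values
    minus a quarter of \<open>B\<close> on the difference; this bounds the distance of two almost
    minimal points.\<close>
  have dist: "c * (norm (y - x'))\<^sup>2 \<le> 2 * (J x' - m) + 2 * (J y - m)" if "x' \<in> S" "y \<in> S" for x' y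
  proof -
    have d: "y - x' \<in> S" using that by (simp add: Sc)
    have mid: "m \<le> J (x' + (1/2) *\<^sub>R (y - x'))" using that by (intro m_le Sc)
    have "c * (norm (y - x'))\<^sup>2 \<le> Re (B (y - x') (y - x'))" using c d by blast
    then show ?thesis
      using J_line[OF that(1) d, of "1/2"] J_line[OF that(1) d, of 1] mid
      by (simp add: power2_eq_square field_simps)
  qed
  have "Cauchy x"
  proof (rule metric_CauchyI)
    fix e :: real assume e: "0 < e"
    obtain N where N: "inverse (real (Suc N)) < c * e\<^sup>2 / 4"
      using reals_Archimedean[of "c * e\<^sup>2 / 4"] c(1) e by auto
    have "dist (x p) (x q) < e" if pq: "p \<ge> N" "q \<ge> N" for p q
    proof -
      have "inverse (real (Suc p)) \<le> inverse (real (Suc N))" "inverse (real (Suc q)) \<le> inverse (real (Suc N))"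
        using pq by (auto intro!: le_imp_inverse_le)
      then have "J (x p) - m < c * e\<^sup>2 / 4" "J (x q) - m < c * e\<^sup>2 / 4"
        using x(2)[of p] x(2)[of q] N by argo+
      then have "c * (norm (x p - x q))\<^sup>2 < c * e\<^sup>2"
        using dist[OF x(1)[of q] x(1)[of p]] by argo
      then show ?thesis using c e by (simp add: dist_norm power2_less_imp_less)
    qed
    then show "\<exists>N. \<forall>p\<ge>N. \<forall>q\<ge>N. dist (x p) (x q) < e" by blast
  qed
  then obtain u where u: "x \<longlonglongrightarrow> u" using Cauchy_convergent convergent_def by blast
  have uS: "u \<in> S" using S(2) x(1) u closed_sequentially by blast
  have re: "Re (B u w) = Re (f w)" if w: "w \<in> S" for w
  proof -
    \<comment> \<open>A step of this length balances the gap between \<open>J (x n)\<close> and m,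
      at most the square of \<open>?d n\<close>, against the quadratic term: after division by the
      step both are of order \<open>?d n\<close>.\<close>
    let ?d = "\<lambda>n. sqrt (inverse (real (Suc n)))"
    have B_lim: "(\<lambda>n. B (x n) w) \<longlonglongrightarrow> B u w"
    proof (rule LIM_zero_cancel, rule Lim_null_comparison)
      show "\<forall>\<^sub>F n in sequentially. norm (B (x n) w - B u w) \<le> C * norm (x n - u) * norm w"
        using C[OF Sc(5)[OF x(1) uS] w] by (auto simp: bs x(1) uS w)
      have "(\<lambda>n. C * norm (x n - u) * norm w) \<longlonglongrightarrow> C * norm (u - u) * norm w"
        by (intro tendsto_intros u)
      then show "(\<lambda>n. C * norm (x n - u) * norm w) \<longlonglongrightarrow> 0" by simp
    qed
    have "\<bar>Re (B (x n) w - f w)\<bar> \<le> (1 + Re (B w w)) * ?d n" for n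
    proof -
      let ?r = "Re (B (x n) w - f w)"
      have d: "?d n > 0" "(?d n)\<^sup>2 = inverse (real (Suc n))" by auto
      have *: "- (?d n)\<^sup>2 \<le> 2 * t * ?r + t\<^sup>2 * Re (B w w)" for t
        using m_le[OF Sc(1)[OF x(1)[of n] Sc(3)[OF w, of t]]] x(2)[of n] J_line[OF x(1)[of n] w, of t] d(2)
        by linarith
      have "0 \<le> ?d n * (?d n + 2 * ?r + ?d n * Re (B w w))"
           "0 \<le> ?d n * (?d n - 2 * ?r + ?d n * Re (B w w))"
        using *[of "?d n"] *[of "- ?d n"] by (simp_all add: algebra_simps power2_eq_square)
      then have "0 \<le> ?d n + 2 * ?r + ?d n * Re (B w w)" "0 \<le> ?d n - 2 * ?r + ?d n * Re (B w w)"
        using d(1) zero_le_mult_iff[of "?d n"] by (meson not_le)+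
      moreover have "0 \<le> c * (norm w)\<^sup>2" using c(1) by simp
      then have "0 \<le> ?d n * Re (B w w)" using c(2)[OF w] d(1) by simp
      ultimately show ?thesis using d(1) by (simp add: algebra_simps abs_le_iff)
    qed
    then have "\<forall>\<^sub>F n in sequentially. norm (Re (B (x n) w - f w)) \<le> (1 + Re (B w w)) * ?d n"
      by simp
    then have "(\<lambda>n. Re (B (x n) w - f w)) \<longlonglongrightarrow> 0"
    proof (rule Lim_null_comparison)
      have "(\<lambda>n. (1 + Re (B w w)) * ?d n) \<longlonglongrightarrow> (1 + Re (B w w)) * sqrt 0"
        by (intro tendsto_intros LIMSEQ_inverse_real_of_nat)
      then show "(\<lambda>n. (1 + Re (B w w)) * ?d n) \<longlonglongrightarrow> 0" by simp
    qed
    moreover have "(\<lambda>n. Re (B (x n) w - f w)) \<longlonglongrightarrow> Re (B u w - f w)"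
      by (intro tendsto_intros B_lim)
    ultimately have "Re (B u w - f w) = 0" using LIMSEQ_unique by blast
    then show ?thesis by simp
  qed
  \<comment> \<open>The real part of the equation at i w is the imaginary part of the equation at
    w.\<close>
  have sol: "B u w = f w" if w: "w \<in> S" for w
    using re[OF w] re[OF Sc(2)[OF w, of \<i>]] w uS by (simp add: bs f_scale complex_eq_iff)
  have "u' = u" if "u' \<in> S" "\<forall>w\<in>S. B u' w = f w" for u'
  proof -
    have d: "u' - u \<in> S" using Sc(5)[OF that(1) uS] .
    have "B (u' - u) (u' - u) = B u' (u' - u) - B u (u' - u)" using bs(9)[OF that(1) uS d] .
    also have "\<dots> = 0" using that(2) sol d by auto
    finally have "B (u' - u) (u' - u) = 0" .
    then have "c * (norm (u' - u))\<^sup>2 \<le> 0" using c(2)[OF d] by simp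
    then show ?thesis using c(1) by (simp add: mult_le_0_iff)
  qed
  then show ?thesis using uS sol by blast
qed

section \<open>Orthogonality with respect to an equivalent inner product\<close>

lemma nrm_eq_form_norm: "nrm a b \<theta> u = form_norm (ip a b \<theta>) u"
  by (simp add: nrm_def form_norm_def)

lemma quad_ip: "quad (ip a b \<theta>) u = quad (a \<theta>) u + quad (b \<theta>) u"
  by (simp add: quad_def ip_def)

lemma nonneg_form_ip:
  assumes "nonneg_form (a \<theta>)" "nonneg_form (b \<theta>)"
  shows "nonneg_form (ip a b \<theta>)"
  using assms unfolding nonneg_form_def sesquilinear_on_def ip_def by (auto simp: algebra_simps)

lemma bounded_linear_form_left:
  fixes g :: "'h::chilbert_space form"
  assumes g: "nonneg_form g" and C: "\<And>u. form_norm g u \<le> C * norm u"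
  shows "bounded_linear (\<lambda>v. g v u)"
proof (rule bounded_linear_intro)
  show "norm (g v u) \<le> norm v * (C * form_norm g u)" for v
  proof -
    have "norm (g v u) \<le> form_norm g v * form_norm g u" by (rule form_cauchy_schwarz[OF g])
    also have "\<dots> \<le> (C * norm v) * form_norm g u"
      using C by (intro mult_right_mono form_norm_ge_zero[OF g])
    finally show ?thesis by (simp add: mult_ac)
  qed
qed (simp_all add: form_simps[OF g] scaleR_conv_of_real)

lemma closed_form_orthogonal:
  fixes g :: "'h::chilbert_space form"
  assumes g: "nonneg_form g" and C: "\<And>u. form_norm g u \<le> C * norm u"
  shows "closed {w. \<forall>v\<in>S. g w v = 0}"
proof -
  have "closed {w. g w v = 0}" for v
    by (intro closed_Collect_eq continuous_intros linear_continuous_on bounded_linear_form_left[OF g C])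
  moreover have "{w. \<forall>v\<in>S. g w v = 0} = (\<Inter>v\<in>S. {w. g w v = 0})" by auto
  ultimately show ?thesis by (simp add: closed_INT)
qed

lemma csubspace_form_orthogonal:
  assumes g: "nonneg_form g"
  shows "csubspace {w. \<forall>v\<in>S. g w v = 0}"
  by (simp add: csubspace_def form_simps[OF g])

text \<open>Since \<open>g\<close> is only equivalent to the inner product of the space, the
  projection comes from \<open>riesz_form\<close> on \<open>S\<close> with the functional
  \<open>g w\<close>; Pythagoras then bounds both parts with constant 1, whatever c and C
  are.\<close>

lemma form_projection:
  fixes g :: "'h::chilbert_space form"
  assumes g: "nonneg_form g"
    and c: "c > 0" "\<And>u. c * norm u \<le> form_norm g u" and C: "\<And>u. form_norm g u \<le> C * norm u"
    and S: "csubspace S" "closed S"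
  obtains p where "p \<in> S" "\<And>v. v \<in> S \<Longrightarrow> g (w - p) v = 0"
    "form_norm g p \<le> form_norm g w" "form_norm g (w - p) \<le> form_norm g w"
proof -
  have bd: "norm (g u v) \<le> \<bar>C\<bar> * \<bar>C\<bar> * norm u * norm v" for u v
  proof -
    have C': "form_norm g u \<le> \<bar>C\<bar> * norm u" for u
      using C[of u] mult_right_mono[OF abs_ge_self[of C] norm_ge_zero[of u]] by linarith
    have "norm (g u v) \<le> form_norm g u * form_norm g v" by (rule form_cauchy_schwarz[OF g])
    also have "\<dots> \<le> (\<bar>C\<bar> * norm u) * (\<bar>C\<bar> * norm v)"
      by (intro mult_mono C' form_norm_ge_zero[OF g] mult_nonneg_nonneg) auto
    finally show ?thesis by (simp add: mult_ac)
  qed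
  have lower: "c\<^sup>2 * (norm u)\<^sup>2 \<le> Re (g u u)" for u
    using power_mono[OF c(2)[of u], of 2] c(1)
    by (simp add: form_norm_square[OF g] power_mult_distrib quad_def)
  have "\<exists>!p. p \<in> S \<and> (\<forall>v\<in>S. g p v = g w v)"
  proof (rule riesz_form[OF S, where c = "c\<^sup>2" and C = "\<bar>C\<bar> * \<bar>C\<bar>" and M = "\<bar>C\<bar> * \<bar>C\<bar> * norm w"])
    show "sesquilinear_on S S g"
      using nonneg_form_sesq[OF g] by (auto simp: sesquilinear_on_def)
    show "g u v = cnj (g v u)" for u v by (rule form_herm[OF g])
    show "norm (g w u) \<le> \<bar>C\<bar> * \<bar>C\<bar> * norm w * norm u" for u by (rule bd)
  qed (use c lower bd in \<open>auto simp: form_simps[OF g]\<close>)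
  then obtain p where p: "p \<in> S" "\<And>v. v \<in> S \<Longrightarrow> g p v = g w v" by blast
  have orth: "g (w - p) v = 0" if "v \<in> S" for v using p(2)[OF that] by (simp add: form_simps[OF g])
  have "g p (w - p) = 0" using orth[OF p(1)] form_herm[OF g, of p "w - p"] by simp
  then have "quad g w = quad g p + quad g (w - p)"
    using form_quad_line[OF g, of p 1 "w - p"] by (simp add: scaleC_one)
  then show ?thesis
    using that[OF p(1) orth] form_diag(2)[OF g] by (simp add: form_norm_def)
qed

text \<open>The angle condition lets the cross term consume at most the fraction \<kappa> of the sum
  of the two squares, so both oblique projections are bounded.\<close>

lemma form_norm_oblique_sum:
  assumes g: "nonneg_form g" and \<kappa>: "0 \<le> \<kappa>" "\<kappa> < 1"
    and vz: "norm (g v z) \<le> \<kappa> * form_norm g v * form_norm g z"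
  shows "form_norm g v \<le> form_norm g (v + z) / sqrt (1 - \<kappa>)"
    and "form_norm g z \<le> form_norm g (v + z) / sqrt (1 - \<kappa>)"
proof -
  have "quad g (v + z) = quad g v + 2 * Re (g v z) + quad g z"
    using form_quad_line[OF g, of v 1 z] by (simp add: scaleC_one)
  moreover have "- (\<kappa> * (form_norm g v * form_norm g z)) \<le> Re (g v z)"
    using vz abs_Re_le_cmod[of "g v z"] by (simp add: mult_ac abs_le_iff)
  moreover have "\<kappa> * (2 * (form_norm g v * form_norm g z)) \<le> \<kappa> * (quad g v + quad g z)"
    using sum_squares_bound[of "form_norm g v" "form_norm g z"] \<kappa>
    by (intro mult_left_mono) (auto simp: form_norm_square[OF g] mult.assoc)
  ultimately have "(1 - \<kappa>) * (quad g v + quad g z) \<le> quad g (v + z)"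
    by (simp add: algebra_simps)
  moreover have "0 \<le> (1 - \<kappa>) * quad g v" "0 \<le> (1 - \<kappa>) * quad g z"
    using \<kappa> form_diag(2)[OF g] by auto
  ultimately have "quad g v * (1 - \<kappa>) \<le> quad g (v + z)" "quad g z * (1 - \<kappa>) \<le> quad g (v + z)"
    by (simp_all add: algebra_simps)
  then show "form_norm g v \<le> form_norm g (v + z) / sqrt (1 - \<kappa>)"
    "form_norm g z \<le> form_norm g (v + z) / sqrt (1 - \<kappa>)"
    using \<kappa> by (simp_all add: form_norm_def pos_le_divide_eq flip: real_sqrt_mult)
qed

lemma antidual_bounded:
  assumes f: "antidual (f :: 'h::chilbert_space \<Rightarrow> complex)"
  obtains M where "\<And>u. norm (f u) \<le> M * norm u"
proof -
  have add: "f (u + v) = f u + f v" and scale: "f (c *\<^sub>C u) = cnj c * f u"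
    and cont: "continuous_on UNIV f" for u v c
    using f by (auto simp: antidual_def)
  have scaleR: "f (t *\<^sub>R u) = of_real t * f u" for t u
    using scale[of "of_real t" u] by (simp add: scaleR_scaleC)
  have f0: "f 0 = 0" using add[of 0 0] by simp
  obtain d where d: "d > 0" "\<And>u. dist u 0 < d \<Longrightarrow> dist (f u) (f 0) < 1"
    using cont unfolding continuous_on_iff by (meson UNIV_I zero_less_one)
  have "norm (f u) \<le> 2 / d * norm u" for u
  proof (cases "u = 0")
    case False
    let ?t = "d / (2 * norm u)"
    have "norm (?t *\<^sub>R u) = d / 2" using False d(1) by simp
    then have "norm (f (?t *\<^sub>R u)) < 1" using d(2)[of "?t *\<^sub>R u"] d(1) f0 by (simp add: dist_norm)
    then have "?t * norm (f u) < 1" using d(1) by (simp add: scaleR norm_mult norm_divide)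
    then show ?thesis using False d(1) by (simp add: field_simps)
  qed (simp add: f0)
  then show ?thesis using that by blast
qed

section \<open>Linear and quadratic dependence on the parameter\<close>

lemma cdot_scaleR: "cdot x (t *\<^sub>R \<theta>) = of_real t * cdot x \<theta>"
  by (simp add: cdot_def sum_distrib_left mult_ac)

lemma cquad_alt:
  "cquad A \<theta> = (\<Sum>i\<in>UNIV. \<Sum>j\<in>UNIV. A $ i $ j * (of_real (\<theta> $ j) * of_real (\<theta> $ i)))"
  by (simp add: cquad_def cdot_def matrix_vector_mult_def sum_distrib_left mult_ac)

lemma cquad_scaleR: "cquad A (t *\<^sub>R \<theta>) = of_real (t\<^sup>2) * cquad A \<theta>"
  by (simp add: cquad_alt sum_distrib_left power2_eq_square mult_ac)

lemma sesquilinear_on_sum: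
  assumes "\<And>i. i \<in> I \<Longrightarrow> sesquilinear_on A B (g i)"
  shows "sesquilinear_on A B (\<lambda>v w. \<Sum>i\<in>I. g i v w * k i)"
  unfolding sesquilinear_on_def
proof (intro conjI allI ballI)
  note s = assms[unfolded sesquilinear_on_def]
  fix c u v w
  show "(\<Sum>i\<in>I. g i (u + v) w * k i) = (\<Sum>i\<in>I. g i u w * k i) + (\<Sum>i\<in>I. g i v w * k i)"
    if "u \<in> A" "v \<in> A" "w \<in> B"
    unfolding sum.distrib[symmetric] using s that by (intro sum.cong) (auto simp: distrib_right)
  show "(\<Sum>i\<in>I. g i (c *\<^sub>C u) w * k i) = c * (\<Sum>i\<in>I. g i u w * k i)" if "u \<in> A" "w \<in> B"
    unfolding sum_distrib_left using s that by (intro sum.cong) auto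
  show "(\<Sum>i\<in>I. g i u (v + w) * k i) = (\<Sum>i\<in>I. g i u v * k i) + (\<Sum>i\<in>I. g i u w * k i)"
    if "u \<in> A" "v \<in> B" "w \<in> B"
    unfolding sum.distrib[symmetric] using s that by (intro sum.cong) (auto simp: distrib_right)
  show "(\<Sum>i\<in>I. g i u (c *\<^sub>C w) * k i) = cnj c * (\<Sum>i\<in>I. g i u w * k i)" if "u \<in> A" "w \<in> B"
    unfolding sum_distrib_left using s that by (intro sum.cong) auto
qed

lemma sesquilinear_on_cdot:
  assumes "\<And>i. sesquilinear_on A B (\<lambda>v w. g v w $ i)"
  shows "sesquilinear_on A B (\<lambda>v w. cdot (g v w) \<theta>)"
  unfolding cdot_def using assms by (rule sesquilinear_on_sum)

lemma sesquilinear_on_cquad: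
  assumes "\<And>i j. sesquilinear_on A B (\<lambda>v w. g v w $ i $ j)"
  shows "sesquilinear_on A B (\<lambda>v w. cquad (g v w) \<theta>)"
proof -
  let ?k = "\<lambda>i j. complex_of_real (\<theta> $ j) * of_real (\<theta> $ i)"
  \<comment> \<open>The dummy weight 1 gives the outer sum the shape of
    \<open>sesquilinear_on_sum\<close>, which is then used twice.\<close>
  have "sesquilinear_on A B (\<lambda>v w. \<Sum>i\<in>UNIV. (\<Sum>j\<in>UNIV. g v w $ i $ j * ?k i j) * 1)"
    using assms by (rule sesquilinear_on_sum[OF sesquilinear_on_sum])
  then show ?thesis by (simp add: cquad_alt)
qed

section \<open>Degenerating families\<close>

text \<open>All constants of the conditions are fixed as parameters, so whatever is built from them
  below is visibly independent of \<theta>, \<epsilon> and f. The removable singularity appears with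
  an actual near point \<open>v2\<close> in place of the infimum, and \<rho> is the radius of a ball
  of parameters around 0, needed for scaling arguments.\<close>

locale degenerate_family =
  fixes \<Theta> :: "(real ^ 'n::finite) set"
    and a b :: "real ^ 'n \<Rightarrow> 'h::chilbert_space \<Rightarrow> 'h \<Rightarrow> complex"
    and a' :: "'h \<Rightarrow> 'h \<Rightarrow> complex ^ 'n"
    and a'' :: "'h \<Rightarrow> 'h \<Rightarrow> complex ^ 'n ^ 'n"
    and Vs Z :: "'h set"
    and E :: "real ^ 'n \<Rightarrow> 'h \<Rightarrow> 'h"
    and \<rho> T c0 C0 K L \<nu> R \<kappa> \<gamma> Ka Kq Lb Kb :: real
  assumes nonneg: "\<theta> \<in> \<Theta> \<Longrightarrow> nonneg_form (a \<theta>)" "\<theta> \<in> \<Theta> \<Longrightarrow> nonneg_form (b \<theta>)"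
    and \<rho>: "0 < \<rho>" "norm \<theta> \<le> \<rho> \<Longrightarrow> \<theta> \<in> \<Theta>"
    and T: "\<theta> \<in> \<Theta> \<Longrightarrow> norm \<theta> \<le> T"
    and c0: "0 < c0" "c0 * norm u \<le> nrm a b 0 u"
    and C0: "0 < C0" "nrm a b 0 u \<le> C0 * norm u"
    and K: "1 \<le> K" "\<theta>1 \<in> \<Theta> \<Longrightarrow> \<theta>2 \<in> \<Theta> \<Longrightarrow> nrm a b \<theta>1 u \<le> K * nrm a b \<theta>2 u"
    and L: "0 \<le> L" "\<theta> \<in> \<Theta> \<Longrightarrow>
      norm (a \<theta> u v - a 0 u v) \<le> L * norm \<theta> * nrm a b 0 u * nrm a b 0 v"
    and \<nu>: "0 < \<nu>" "w \<in> W a b 0 \<Longrightarrow> \<nu> * (nrm a b 0 w)\<^sup>2 \<le> quad (a 0) w"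
    and Vs: "csubspace Vs"
    and R: "0 \<le> R" "\<theta>1 \<in> \<Theta> \<Longrightarrow> \<theta>2 \<in> \<Theta> \<Longrightarrow> v1 \<in> Vstar a Vs \<theta>1 \<Longrightarrow>
      \<exists>v2\<in>Vstar a Vs \<theta>2. nrm a b \<theta>2 (v1 - v2) \<le> R * norm (\<theta>1 - \<theta>2) * nrm a b \<theta>1 v1"
    and Z: "csubspace Z"
    and V0_sum: "direct_sum (V a 0) Vs Z"
    and \<kappa>: "0 \<le> \<kappa>" "\<kappa> < 1"
      "v \<in> Vs \<Longrightarrow> z \<in> Z \<Longrightarrow> norm (ip a b 0 v z) \<le> \<kappa> * nrm a b 0 v * nrm a b 0 z"
    and \<gamma>: "0 < \<gamma>" "\<theta> \<in> \<Theta> \<Longrightarrow> w \<in> W a b \<theta> \<Longrightarrow>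
      \<gamma> * (norm \<theta>)\<^sup>2 * (nrm a b \<theta> w)\<^sup>2 \<le> quad (a \<theta>) w"
    and a'_sesq: "sesquilinear_on (V a 0) UNIV (\<lambda>v u. a' v u $ i)"
    and a''_sesq: "sesquilinear_on (V a 0) (V a 0) (\<lambda>v u. a'' v u $ i $ j)"
    and Ka: "0 \<le> Ka" "v \<in> V a 0 \<Longrightarrow> \<theta> \<in> \<Theta> \<Longrightarrow>
      norm (a \<theta> v u - cdot (a' v u) \<theta>) \<le> Ka * (norm \<theta>)\<^sup>2 * nrm a b 0 v * nrm a b 0 u"
    and Kq: "0 \<le> Kq" "v \<in> V a 0 \<Longrightarrow> w \<in> V a 0 \<Longrightarrow> \<theta> \<in> \<Theta> \<Longrightarrow>
      norm (a \<theta> v w - cquad (a'' v w) \<theta>) \<le> Kq * (norm \<theta>) ^ 3 * nrm a b 0 v * nrm a b 0 w"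
    and Lb: "0 \<le> Lb" "v \<in> V a 0 \<Longrightarrow> w \<in> V a 0 \<Longrightarrow> \<theta> \<in> \<Theta> \<Longrightarrow>
      norm (b \<theta> v w - b 0 v w) \<le> Lb * norm \<theta> * nrm a b 0 v * nrm a b \<theta> w"
    and E_lin: "\<theta> \<in> \<Theta> \<Longrightarrow> clinear_on Vs (E \<theta>)"
    and E_bij: "\<theta> \<in> \<Theta> \<Longrightarrow> bij_betw (E \<theta>) Vs (Vstar a Vs \<theta>)"
    and E_iso: "\<theta> \<in> \<Theta> \<Longrightarrow> v \<in> Vs \<Longrightarrow> w \<in> Vs \<Longrightarrow> b \<theta> (E \<theta> v) (E \<theta> w) = b 0 v w"
    and Kb: "0 \<le> Kb" "\<theta> \<in> \<Theta> \<Longrightarrow> v \<in> Vs \<Longrightarrow> z \<in> Z \<Longrightarrow>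
      norm (b \<theta> (E \<theta> v) z - b 0 v z) \<le> Kb * norm \<theta> * nrm a b 0 v * nrm a b 0 z"
begin

abbreviation N :: "'h \<Rightarrow> real" where "N \<equiv> nrm a b 0"

abbreviation V0 :: "'h set" where "V0 \<equiv> V a 0"

abbreviation corr :: "real ^ 'n \<Rightarrow> 'h \<Rightarrow> 'h" where "corr \<equiv> corrector a b a'"

abbreviation hom :: "real ^ 'n \<Rightarrow> 'h \<Rightarrow> 'h \<Rightarrow> complex" where "hom \<equiv> hom_form a b a' a''"

section \<open>Uniform norm bounds, kernels and their orthogonal complements\<close>

lemma zero_mem: "0 \<in> \<Theta>"
  using \<rho> by simp

lemma ip_nonneg: "\<theta> \<in> \<Theta> \<Longrightarrow> nonneg_form (ip a b \<theta>)"
  by (simp add: nonneg nonneg_form_ip)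

lemmas a_simps = form_simps[OF nonneg(1)]
  and b_simps = form_simps[OF nonneg(2)]
  and a0_simps = form_simps[OF nonneg(1)[OF zero_mem]]
  and b0_simps = form_simps[OF nonneg(2)[OF zero_mem]]

lemma nrm_nonneg: "\<theta> \<in> \<Theta> \<Longrightarrow> 0 \<le> nrm a b \<theta> u"
  by (simp add: nrm_eq_form_norm form_norm_ge_zero ip_nonneg)

lemma N_nonneg [simp]: "0 \<le> N u"
  by (simp add: nrm_nonneg zero_mem)

lemma K_nonneg [simp]: "0 \<le> K"
  using K(1) by simp

lemma T_nonneg: "0 \<le> T"
  using T[OF zero_mem] by simp

lemma nrm_le_N: "\<theta> \<in> \<Theta> \<Longrightarrow> nrm a b \<theta> u \<le> K * N u"
  and N_le_nrm: "\<theta> \<in> \<Theta> \<Longrightarrow> N u \<le> K * nrm a b \<theta> u"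
  by (rule K(2); simp add: zero_mem)+

lemma
  assumes "\<theta> \<in> \<Theta>"
  shows nrm_triangle: "nrm a b \<theta> (u + v) \<le> nrm a b \<theta> u + nrm a b \<theta> v"
    and nrm_triangle_diff: "nrm a b \<theta> (u - v) \<le> nrm a b \<theta> u + nrm a b \<theta> v"
  unfolding nrm_eq_form_norm
  by (rule form_norm_triangle form_norm_triangle_diff, rule ip_nonneg[OF assms])+

lemmas N_triangle = nrm_triangle[OF zero_mem]
  and N_triangle_diff = nrm_triangle_diff[OF zero_mem]

lemma nrm_square: "\<theta> \<in> \<Theta> \<Longrightarrow> (nrm a b \<theta> u)\<^sup>2 = quad (a \<theta>) u + quad (b \<theta>) u"
  by (simp add: nrm_eq_form_norm form_norm_square ip_nonneg quad_ip)

lemma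
  assumes "\<theta> \<in> \<Theta>"
  shows a_norm_le: "form_norm (a \<theta>) u \<le> nrm a b \<theta> u"
    and b_norm_le: "form_norm (b \<theta>) u \<le> nrm a b \<theta> u"
  using form_diag(2)[OF nonneg(1)[OF assms], of u] form_diag(2)[OF nonneg(2)[OF assms], of u]
  by (simp_all add: form_norm_def nrm_def quad_ip)

lemma
  assumes \<theta>: "\<theta> \<in> \<Theta>"
  shows a_bound_nrm: "norm (a \<theta> u v) \<le> nrm a b \<theta> u * nrm a b \<theta> v"
    and b_bound_nrm: "norm (b \<theta> u v) \<le> nrm a b \<theta> u * nrm a b \<theta> v"
proof -
  note n = nonneg(1)[OF \<theta>] nonneg(2)[OF \<theta>]
  have "norm (a \<theta> u v) \<le> form_norm (a \<theta>) u * form_norm (a \<theta>) v"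
    "norm (b \<theta> u v) \<le> form_norm (b \<theta>) u * form_norm (b \<theta>) v"
    by (intro form_cauchy_schwarz n)+
  then show "norm (a \<theta> u v) \<le> nrm a b \<theta> u * nrm a b \<theta> v"
    "norm (b \<theta> u v) \<le> nrm a b \<theta> u * nrm a b \<theta> v"
    using mult_mono[OF a_norm_le[OF \<theta>, of u] a_norm_le[OF \<theta>, of v] nrm_nonneg[OF \<theta>]
        form_norm_ge_zero[OF n(1)]]
      mult_mono[OF b_norm_le[OF \<theta>, of u] b_norm_le[OF \<theta>, of v] nrm_nonneg[OF \<theta>]
        form_norm_ge_zero[OF n(2)]]
    by linarith+
qed

lemma a_bound_N:
  assumes \<theta>: "\<theta> \<in> \<Theta>"
  shows "norm (a \<theta> u v) \<le> K\<^sup>2 * N u * N v"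
proof -
  have "nrm a b \<theta> u * nrm a b \<theta> v \<le> (K * N u) * (K * N v)"
    by (intro mult_mono nrm_le_N[OF \<theta>] nrm_nonneg[OF \<theta>] mult_nonneg_nonneg) simp_all
  then show ?thesis
    using a_bound_nrm[OF \<theta>, of u v] by (simp add: power2_eq_square mult_ac)
qed

lemma
  assumes \<theta>: "\<theta> \<in> \<Theta>"
  shows nrm_equiv: "c0 / K * norm u \<le> nrm a b \<theta> u" "nrm a b \<theta> u \<le> K * C0 * norm u"
proof -
  have "c0 * norm u \<le> K * nrm a b \<theta> u"
    using c0(2)[of u] N_le_nrm[OF \<theta>, of u] by linarith
  then show "c0 / K * norm u \<le> nrm a b \<theta> u" using K(1) by (simp add: field_simps)
  have "K * N u \<le> K * (C0 * norm u)" using C0(2) by (intro mult_left_mono) auto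
  then show "nrm a b \<theta> u \<le> K * C0 * norm u" using nrm_le_N[OF \<theta>, of u] by (simp add: mult_ac)
qed

lemma V_iff: "\<theta> \<in> \<Theta> \<Longrightarrow> v \<in> V a \<theta> \<longleftrightarrow> (\<forall>u. a \<theta> v u = 0)"
  unfolding V_def mem_Collect_eq by (blast intro: form_null(1)[OF nonneg(1)])

lemma
  assumes "\<theta> \<in> \<Theta>" "v \<in> V a \<theta>"
  shows a_V_left: "a \<theta> v u = 0" and a_V_right: "a \<theta> u v = 0"
  using form_null[OF nonneg(1)[OF assms(1)], of v u] assms(2) by (simp_all add: V_def)

lemma
  assumes \<theta>: "\<theta> \<in> \<Theta>"
  shows V_subspace: "csubspace (V a \<theta>)" and V_closed: "closed (V a \<theta>)"
proof -
  have conj: "V a \<theta> = {v. \<forall>u\<in>UNIV. a \<theta> v u = 0}" using V_iff[OF \<theta>] by auto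
  show "csubspace (V a \<theta>)" unfolding conj by (rule csubspace_form_orthogonal[OF nonneg(1)[OF \<theta>]])
  show "closed (V a \<theta>)"
    unfolding conj
  proof (rule closed_form_orthogonal[OF nonneg(1)[OF \<theta>]])
    show "form_norm (a \<theta>) u \<le> K * C0 * norm u" for u
      using a_norm_le[OF \<theta>, of u] nrm_equiv(2)[OF \<theta>, of u] by linarith
  qed
qed

lemma
  assumes \<theta>: "\<theta> \<in> \<Theta>"
  shows W_subspace: "csubspace (W a b \<theta>)" and W_closed: "closed (W a b \<theta>)"
  unfolding W_def
  by (rule csubspace_form_orthogonal[OF ip_nonneg[OF \<theta>]])
    (rule closed_form_orthogonal[OF ip_nonneg[OF \<theta>] nrm_equiv(2)[OF \<theta>, unfolded nrm_eq_form_norm]])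

lemma orthogonal_split:
  assumes \<theta>: "\<theta> \<in> \<Theta>"
  obtains p q where "w = p + q" "p \<in> V a \<theta>" "q \<in> W a b \<theta>"
    "nrm a b \<theta> p \<le> nrm a b \<theta> w" "nrm a b \<theta> q \<le> nrm a b \<theta> w"
proof -
  have "0 < c0 / K" using c0 K(1) by simp
  then obtain p where p: "p \<in> V a \<theta>" "\<And>v. v \<in> V a \<theta> \<Longrightarrow> ip a b \<theta> (w - p) v = 0"
    "form_norm (ip a b \<theta>) p \<le> form_norm (ip a b \<theta>) w"
    "form_norm (ip a b \<theta>) (w - p) \<le> form_norm (ip a b \<theta>) w"
    using form_projection[OF ip_nonneg[OF \<theta>], of "c0 / K" "K * C0" "V a \<theta>" w]
      V_subspace[OF \<theta>] V_closed[OF \<theta>] nrm_equiv[OF \<theta>]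
    by (auto simp: nrm_eq_form_norm)
  show ?thesis
    using that[of p "w - p"] p by (auto simp: W_def nrm_eq_form_norm)
qed

section \<open>The oblique sum of \<open>Vs\<close> and \<open>Z\<close>\<close>

lemma V0_decompose:
  assumes "x \<in> V0"
  obtains v z where "v \<in> Vs" "z \<in> Z" "x = v + z"
  using assms V0_sum unfolding direct_sum_def by auto

lemma V0_add: "v \<in> Vs \<Longrightarrow> z \<in> Z \<Longrightarrow> v + z \<in> V0"
  using V0_sum unfolding direct_sum_def by auto

lemma Vs_subset: "v \<in> Vs \<Longrightarrow> v \<in> V0" and Z_subset: "z \<in> Z \<Longrightarrow> z \<in> V0"
  using V0_add[of v 0] V0_add[of 0 z] csubspace_zero[OF Vs] csubspace_zero[OF Z] by auto

lemma V0_unique: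
  assumes "v \<in> Vs" "z \<in> Z" "v' \<in> Vs" "z' \<in> Z" "v + z = v' + z'"
  shows "v = v'" "z = z'"
proof -
  have "v - v' = z' - z" using assms(5) by (simp add: algebra_simps)
  moreover have "v - v' \<in> Vs" "z' - z \<in> Z" using assms csubspace_diff Vs Z by auto
  ultimately have "v - v' \<in> Vs \<inter> Z" by simp
  then have "v - v' = 0" using V0_sum unfolding direct_sum_def by auto
  then show "v = v'" "z = z'" using assms(5) by auto
qed

text \<open>A common bound for the two oblique projections of \<open>V0\<close>, onto
  \<open>Vs\<close> along \<open>Z\<close> and onto \<open>Z\<close> along
  \<open>Vs\<close>.\<close>

definition \<sigma> :: real where "\<sigma> = 1 / sqrt (1 - \<kappa>)"

lemma \<sigma>_nonneg [simp]: "0 \<le> \<sigma>" and \<sigma>_pos: "0 < \<sigma>"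
  using \<kappa> by (auto simp: \<sigma>_def)

lemma
  assumes "v \<in> Vs" "z \<in> Z"
  shows N_left_le: "N v \<le> \<sigma> * N (v + z)" and N_right_le: "N z \<le> \<sigma> * N (v + z)"
  using form_norm_oblique_sum[OF ip_nonneg[OF zero_mem] \<kappa>(1,2), of v z] \<kappa>(3)[OF assms]
  by (simp_all add: nrm_eq_form_norm \<sigma>_def)

section \<open>The corrector and the homogenised form\<close>

text \<open>The conditions speak only about parameters in \<Theta>, whereas the homogenised form is
  needed at \<theta> / \<epsilon>, anywhere in the parameter space. Facts that are homogeneous in
  \<theta> are carried over along rays.\<close>

lemma small_multiple_mem:
  fixes \<theta> :: "real ^ 'n"
  obtains t0 where "0 < t0" "t0 \<le> 1" "\<And>t. 0 < t \<Longrightarrow> t \<le> t0 \<Longrightarrow> t *\<^sub>R \<theta> \<in> \<Theta>"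
proof
  \<comment> \<open>The summand 1 keeps the quotient positive for \<theta> = 0, where division by
    zero would give 0.\<close>
  define t0 where "t0 = min 1 (\<rho> / (norm \<theta> + 1))"
  show "0 < t0" "t0 \<le> 1"
    using \<rho>(1) by (auto simp: t0_def add_nonneg_pos)
  fix t :: real assume t: "0 < t" "t \<le> t0"
  have "t * norm \<theta> \<le> t0 * (norm \<theta> + 1)" using t by (intro mult_mono) auto
  also have "\<dots> \<le> \<rho> / (norm \<theta> + 1) * (norm \<theta> + 1)"
    by (intro mult_right_mono) (auto simp: t0_def)
  also have "\<dots> = \<rho>" using norm_ge_zero[of \<theta>] by (simp add: add_nonneg_eq_0_iff)
  finally show "t *\<^sub>R \<theta> \<in> \<Theta>" using t \<rho>(2) by simp
qed

lemma cdot_zero_right [simp]: "cdot x 0 = 0"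
  and cquad_zero_right [simp]: "cquad A 0 = 0"
  by (simp_all add: cdot_def cquad_alt)

definition Ca :: real where "Ca = (K\<^sup>2 + Ka * \<rho>\<^sup>2) / \<rho>"

lemma Ca_nonneg [simp]: "0 \<le> Ca"
  using \<rho> Ka by (simp add: Ca_def)

text \<open>By linearity in \<theta> it suffices to look at the sphere of radius \<rho>, inside
  \<Theta>, where the expression differs from the bounded form \<open>a\<close> by at most the
  regularity error; this is the origin of \<open>Ca\<close>. \<open>Cq\<close> arises in the same
  way with degree two.\<close>

lemma cdot_bound:
  assumes v: "v \<in> V0"
  shows "norm (cdot (a' v u) \<theta>) \<le> Ca * norm \<theta> * N v * N u"
proof (cases "\<theta> = 0")
  case False
  let ?s = "\<rho> / norm \<theta>"
  have mem: "?s *\<^sub>R \<theta> \<in> \<Theta>" using \<rho> False by simp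
  have "norm (cdot (a' v u) (?s *\<^sub>R \<theta>)) \<le> norm (a (?s *\<^sub>R \<theta>) v u) + Ka * \<rho>\<^sup>2 * N v * N u"
    using Ka(2)[OF v mem, of u] norm_triangle_sub[of "cdot (a' v u) (?s *\<^sub>R \<theta>)" "a (?s *\<^sub>R \<theta>) v u"]
      False \<rho> by (simp add: norm_minus_commute)
  also have "\<dots> \<le> K\<^sup>2 * N v * N u + Ka * \<rho>\<^sup>2 * N v * N u"
    using a_bound_N[OF mem] by simp
  finally have "?s * norm (cdot (a' v u) \<theta>) \<le> (K\<^sup>2 + Ka * \<rho>\<^sup>2) * N v * N u"
    using \<rho>(1) by (simp add: cdot_scaleR norm_mult norm_divide algebra_simps)
  then show ?thesis
    using \<rho>(1) False by (simp add: Ca_def field_simps)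
qed simp

definition Cq :: real where "Cq = (K\<^sup>2 + Kq * \<rho>^3) / \<rho>\<^sup>2"

lemma cquad_bound:
  assumes v: "v \<in> V0" "w \<in> V0"
  shows "norm (cquad (a'' v w) \<theta>) \<le> Cq * (norm \<theta>)\<^sup>2 * N v * N w"
proof (cases "\<theta> = 0")
  case False
  let ?s = "\<rho> / norm \<theta>"
  have mem: "?s *\<^sub>R \<theta> \<in> \<Theta>" using \<rho> False by simp
  have "norm (cquad (a'' v w) (?s *\<^sub>R \<theta>)) \<le> norm (a (?s *\<^sub>R \<theta>) v w) + Kq * \<rho>^3 * N v * N w"
    using Kq(2)[OF v mem] norm_triangle_sub[of "cquad (a'' v w) (?s *\<^sub>R \<theta>)" "a (?s *\<^sub>R \<theta>) v w"]
      False \<rho> by (simp add: norm_minus_commute)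
  also have "\<dots> \<le> K\<^sup>2 * N v * N w + Kq * \<rho>^3 * N v * N w"
    using a_bound_N[OF mem] by simp
  finally have "?s\<^sup>2 * norm (cquad (a'' v w) \<theta>) \<le> (K\<^sup>2 + Kq * \<rho>^3) * N v * N w"
    unfolding cquad_scaleR norm_mult norm_of_real by (simp add: algebra_simps)
  then show ?thesis
    using \<rho>(1) False by (simp add: Cq_def field_simps)
qed simp

text \<open>On \<open>V0\<close> the second regularity condition makes \<open>a\<close> at
  \<open>t *\<^sub>R \<theta>\<close> of order t^2, while the first gives t times the linear part up
  to order t^2. Dividing by t leaves no room for a linear part.\<close>

lemma cdot_V0:
  assumes v: "v \<in> V0" "w \<in> V0"
  shows "cdot (a' v w) \<theta> = 0"
proof -
  obtain t0 where t0: "0 < t0" "t0 \<le> 1" "\<And>t. 0 < t \<Longrightarrow> t \<le> t0 \<Longrightarrow> t *\<^sub>R \<theta> \<in> \<Theta>"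
    using small_multiple_mem[of \<theta>] by blast
  define C where "C = Ka * (norm \<theta>)\<^sup>2 * N v * N w + norm (cquad (a'' v w) \<theta>)
    + Kq * (norm \<theta>)^3 * N v * N w"
  have "norm (cdot (a' v w) \<theta>) \<le> C * t" if t: "0 < t" "t \<le> t0" for t
  proof -
    note mem = t0(3)[OF t]
    have "norm (cdot (a' v w) (t *\<^sub>R \<theta>)) \<le> norm (a (t *\<^sub>R \<theta>) v w - cdot (a' v w) (t *\<^sub>R \<theta>))
      + norm (a (t *\<^sub>R \<theta>) v w - cquad (a'' v w) (t *\<^sub>R \<theta>)) + norm (cquad (a'' v w) (t *\<^sub>R \<theta>))"
      by norm
    also have "\<dots> \<le> Ka * (norm (t *\<^sub>R \<theta>))\<^sup>2 * N v * N w
      + Kq * (norm (t *\<^sub>R \<theta>))^3 * N v * N w + norm (cquad (a'' v w) (t *\<^sub>R \<theta>))"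
      using Ka(2)[OF v(1) mem, of w] Kq(2)[OF v mem] by linarith
    also have "\<dots> = t * t * (Ka * (norm \<theta>)\<^sup>2 * N v * N w + norm (cquad (a'' v w) \<theta>)
      + t * (Kq * (norm \<theta>)^3 * N v * N w))"
      unfolding cquad_scaleR norm_mult norm_of_real norm_scaleR power_mult_distrib using t
      by (simp add: algebra_simps power2_eq_square power3_eq_cube)
    also have "\<dots> \<le> t * t * C"
    proof -
      have "t * (Kq * (norm \<theta>)^3 * N v * N w) \<le> 1 * (Kq * (norm \<theta>)^3 * N v * N w)"
        using t t0 Kq(1) by (intro mult_right_mono) auto
      then show ?thesis unfolding C_def using t by (intro mult_left_mono) auto
    qed
    finally have "t * norm (cdot (a' v w) \<theta>) \<le> t * (C * t)"
      using t by (simp add: cdot_scaleR norm_mult mult_ac)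
    then show ?thesis using t by simp
  qed
  then have "norm (cdot (a' v w) \<theta>) \<le> 0" by (rule le_zero_if_le_linear[OF t0(1)])
  then show ?thesis by simp
qed

lemma cdot_sesq: "sesquilinear_on V0 UNIV (\<lambda>v u. cdot (a' v u) \<theta>)"
  and cquad_sesq: "sesquilinear_on V0 V0 (\<lambda>v u. cquad (a'' v u) \<theta>)"
  by (rule sesquilinear_on_cdot sesquilinear_on_cquad, rule a'_sesq a''_sesq)+

lemmas V0_subspace = V_subspace[OF zero_mem]
  and W0_subspace = W_subspace[OF zero_mem]

lemmas cdot_simps = sesq_simps[OF cdot_sesq V0_subspace csubspace_UNIV]
  and cquad_simps = sesq_simps[OF cquad_sesq V0_subspace V0_subspace]
  and V0_ops = csubspace_closed_ops[OF V0_subspace]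
  and W0_ops = csubspace_closed_ops[OF W0_subspace]

text \<open>The spectral gap at \<theta> = 0 is the coercivity of \<open>a 0\<close> on
  \<open>W a b 0\<close>; the constants convert \<open>N\<close> into the norm of the space.\<close>

lemma corr_ex1:
  assumes v: "v \<in> V0"
  shows "\<exists>!w. w \<in> W a b 0 \<and> (\<forall>w'\<in>W a b 0. a 0 w w' = - cdot (a' v w') \<theta>)"
proof (rule riesz_form[OF W0_subspace W_closed[OF zero_mem],
      where c = "\<nu> * c0\<^sup>2" and C = "C0 * C0" and M = "Ca * norm \<theta> * N v * C0"])
  show "sesquilinear_on (W a b 0) (W a b 0) (a 0)"
    using nonneg_form_sesq[OF nonneg(1)[OF zero_mem]] by (auto simp: sesquilinear_on_def)
  show "a 0 u w = cnj (a 0 w u)" for u w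
    by (rule form_herm[OF nonneg(1)[OF zero_mem]])
  show "0 < \<nu> * c0\<^sup>2" using \<nu> c0 by simp
  show "\<nu> * c0\<^sup>2 * (norm u)\<^sup>2 \<le> Re (a 0 u u)" if "u \<in> W a b 0" for u
  proof -
    have "(c0 * norm u)\<^sup>2 \<le> (N u)\<^sup>2" using c0 by (intro power_mono) auto
    then have "\<nu> * (c0 * norm u)\<^sup>2 \<le> \<nu> * (N u)\<^sup>2" using \<nu>(1) by simp
    then show ?thesis using \<nu>(2)[OF that] by (simp add: power_mult_distrib quad_def mult_ac)
  qed
  show "norm (a 0 u w) \<le> C0 * C0 * norm u * norm w" for u w
  proof -
    have "N u * N w \<le> (C0 * norm u) * (C0 * norm w)" using C0 by (intro mult_mono) auto
    then show ?thesis using a_bound_nrm[OF zero_mem, of u w] by (simp add: mult_ac)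
  qed
  show "norm (- cdot (a' v u) \<theta>) \<le> Ca * norm \<theta> * N v * C0 * norm u" for u
  proof -
    have "Ca * norm \<theta> * N v * N u \<le> Ca * norm \<theta> * N v * (C0 * norm u)"
      by (intro mult_left_mono C0 mult_nonneg_nonneg) auto
    then show ?thesis using cdot_bound[OF v, of u \<theta>] by (simp add: mult_ac)
  qed
qed (simp_all add: cdot_simps v)

text \<open>These facts stand in for the definite description from here on; linearity in v and
  homogeneity in \<theta> both follow from uniqueness.\<close>

lemma
  assumes "v \<in> V0"
  shows corr_mem: "corr \<theta> v \<in> W a b 0"
    and corr_eq: "w \<in> W a b 0 \<Longrightarrow> a 0 (corr \<theta> v) w = - cdot (a' v w) \<theta>"
    and corr_unique: "y \<in> W a b 0 \<Longrightarrow> (\<And>w. w \<in> W a b 0 \<Longrightarrow> a 0 y w = - cdot (a' v w) \<theta>) \<Longrightarrow> corr \<theta> v = y"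
  using theI'[OF corr_ex1[OF assms, of \<theta>]] the1_equality[OF corr_ex1[OF assms, of \<theta>], of y]
  unfolding corrector_def by auto

lemma corr_add: "v \<in> V0 \<Longrightarrow> w \<in> V0 \<Longrightarrow> corr \<theta> (v + w) = corr \<theta> v + corr \<theta> w"
  by (rule corr_unique) (simp_all add: V0_ops(1) W0_ops(1) corr_mem a0_simps corr_eq cdot_simps)

lemma corr_scaleC: "v \<in> V0 \<Longrightarrow> corr \<theta> (c *\<^sub>C v) = c *\<^sub>C corr \<theta> v"
  by (rule corr_unique) (simp_all add: V0_ops(2) W0_ops(2) corr_mem a0_simps corr_eq cdot_simps)

lemma corr_scaleR_arg: "v \<in> V0 \<Longrightarrow> corr (t *\<^sub>R \<theta>) v = t *\<^sub>R corr \<theta> v"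
  by (rule corr_unique) (simp_all add: W0_ops(3) corr_mem a0_simps corr_eq cdot_scaleR)

definition Cn :: real where "Cn = Ca / \<nu>"

lemma Cn_nonneg [simp]: "0 \<le> Cn"
  using \<nu> by (simp add: Cn_def)

text \<open>The corrector equation is tested with the corrector itself, and one factor is
  cancelled.\<close>

lemma corr_bound:
  assumes v: "v \<in> V0"
  shows "N (corr \<theta> v) \<le> Cn * norm \<theta> * N v"
proof (cases "N (corr \<theta> v) = 0")
  case False
  then have pos: "N (corr \<theta> v) > 0" by (simp add: order_less_le)
  have "\<nu> * (N (corr \<theta> v))\<^sup>2 \<le> norm (a 0 (corr \<theta> v) (corr \<theta> v))"
    using \<nu>(2)[OF corr_mem[OF v, of \<theta>]] complex_Re_le_cmod[of "a 0 (corr \<theta> v) (corr \<theta> v)"]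
    unfolding quad_def by linarith
  also have "\<dots> \<le> Ca * norm \<theta> * N v * N (corr \<theta> v)"
    unfolding corr_eq[OF v corr_mem[OF v]] norm_minus_cancel by (rule cdot_bound[OF v])
  finally have "\<nu> * N (corr \<theta> v) \<le> Ca * norm \<theta> * N v" using pos by (simp add: power2_eq_square)
  then show ?thesis using \<nu>(1) by (simp add: Cn_def field_simps)
qed simp

definition Cm :: real where "Cm = Ka + L * Cn"

lemma Cm_nonneg [simp]: "0 \<le> Cm"
  using Ka L by (simp add: Cm_def)

text \<open>The corrector cancels the part of \<open>a \<theta> v u\<close> that is linear in \<open>\<theta>\<close>: on \<open>W a b 0\<close> by its
  definition, and on \<open>V a 0\<close> because there that part vanishes.\<close>

lemma a_corrected_bound:
  assumes \<theta>: "\<theta> \<in> \<Theta>" and v: "v \<in> V0"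
  shows "norm (a \<theta> (v + corr \<theta> v) u) \<le> Cm * (norm \<theta>)\<^sup>2 * N v * N u"
proof -
  obtain p q where u: "u = p + q" "p \<in> V0" "q \<in> W a b 0"
    by (rule orthogonal_split[OF zero_mem, of u])
  have "a 0 (corr \<theta> v) u = a 0 (corr \<theta> v) q"
    using a_V_right[OF zero_mem u(2)] by (simp add: u(1) a0_simps)
  also have "\<dots> = - cdot (a' v u) \<theta>"
    by (simp add: corr_eq[OF v u(3)] u(1) cdot_simps v cdot_V0[OF v u(2)])
  finally have c: "cdot (a' v u) \<theta> = - a 0 (corr \<theta> v) u" by simp
  have "norm (a \<theta> (v + corr \<theta> v) u) \<le> norm (a \<theta> v u - cdot (a' v u) \<theta>)
    + norm (a \<theta> (corr \<theta> v) u - a 0 (corr \<theta> v) u)"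
    unfolding c using norm_triangle_ineq[of "a \<theta> v u + a 0 (corr \<theta> v) u"
      "a \<theta> (corr \<theta> v) u - a 0 (corr \<theta> v) u"] by (simp add: a_simps \<theta>)
  also have "\<dots> \<le> Ka * (norm \<theta>)\<^sup>2 * N v * N u + L * norm \<theta> * N (corr \<theta> v) * N u"
    using Ka(2)[OF v \<theta>, of u] L(2)[OF \<theta>, of "corr \<theta> v" u] by linarith
  \<comment> \<open>Replacing \<open>a \<theta>\<close> by \<open>a 0\<close> on the corrector costs
    one factor |\<theta>|, and the corrector is itself of order |\<theta>|.\<close>
  also have "L * norm \<theta> * N (corr \<theta> v) * N u \<le> L * norm \<theta> * (Cn * norm \<theta> * N v) * N u"
    using L(1) by (intro mult_right_mono mult_left_mono corr_bound[OF v]) auto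
  finally show ?thesis by (simp add: Cm_def algebra_simps power2_eq_square)
qed

definition Ch :: real where "Ch = Kq + Ka * Cn"

lemma Ch_nonneg [simp]: "0 \<le> Ch"
  using Ka Kq by (simp add: Ch_def)

text \<open>Testing with \<open>w\<close> in \<open>V0\<close> gains an order: by Hermitian symmetry
  \<open>a \<theta>\<close> on the corrector of \<open>v\<close> and \<open>w\<close> can be
  expanded in the slot of \<open>w\<close>. Its linear part is, by the corrector equation for
  \<open>w\<close>, exactly the corrector product in the homogenised form, and the remainder
  |\<theta>|^2 multiplies a corrector of order |\<theta>|.\<close>

lemma hom_approx:
  assumes \<theta>: "\<theta> \<in> \<Theta>" and v: "v \<in> V0" "w \<in> V0"
  shows "norm (a \<theta> (v + corr \<theta> v) w - hom \<theta> v w) \<le> Ch * (norm \<theta>)^3 * N v * N w"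
proof -
  let ?c = "corr \<theta> v"
  have "cdot (a' w ?c) \<theta> = - a 0 (corr \<theta> w) ?c"
    by (simp add: corr_eq[OF v(2) corr_mem[OF v(1)]])
  moreover have "a \<theta> ?c w = cnj (a \<theta> w ?c)" "a 0 ?c (corr \<theta> w) = cnj (a 0 (corr \<theta> w) ?c)"
    by (rule form_herm nonneg \<theta> zero_mem)+
  ultimately have "a \<theta> ?c w + a 0 ?c (corr \<theta> w) = cnj (a \<theta> w ?c - cdot (a' w ?c) \<theta>)"
    by simp
  then have "norm (a \<theta> ?c w + a 0 ?c (corr \<theta> w)) = norm (a \<theta> w ?c - cdot (a' w ?c) \<theta>)"
    by (metis complex_mod_cnj)
  also have "\<dots> \<le> Ka * (norm \<theta>)\<^sup>2 * N w * N ?c" by (rule Ka(2)[OF v(2) \<theta>])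
  also have "\<dots> \<le> Ka * (norm \<theta>)\<^sup>2 * N w * (Cn * norm \<theta> * N v)"
    using Ka(1) by (intro mult_left_mono corr_bound[OF v(1)]) auto
  finally have c: "norm (a \<theta> ?c w + a 0 ?c (corr \<theta> w)) \<le> Ka * Cn * (norm \<theta>)^3 * N v * N w"
    by (simp add: power2_eq_square power3_eq_cube mult_ac)
  have "a \<theta> (v + ?c) w - hom \<theta> v w
    = (a \<theta> v w - cquad (a'' v w) \<theta>) + (a \<theta> ?c w + a 0 ?c (corr \<theta> w))"
    by (simp add: a_simps \<theta> hom_form_def)
  then have "norm (a \<theta> (v + ?c) w - hom \<theta> v w)
    \<le> norm (a \<theta> v w - cquad (a'' v w) \<theta>) + norm (a \<theta> ?c w + a 0 ?c (corr \<theta> w))"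
    using norm_triangle_ineq by metis
  then show ?thesis
    using Kq(2)[OF v \<theta>] c by (simp add: Ch_def algebra_simps)
qed

lemma hom_scaleR_arg:
  assumes "v \<in> V0" "w \<in> V0"
  shows "hom (t *\<^sub>R \<theta>) v w = of_real (t\<^sup>2) * hom \<theta> v w"
  using assms
  by (simp add: hom_form_def cquad_scaleR corr_scaleR_arg a0_simps zero_mem algebra_simps power2_eq_square)

lemma hom_sesq: "sesquilinear_on V0 V0 (hom \<theta>)"
  unfolding sesquilinear_on_def hom_form_def
  by (simp add: cquad_simps corr_add corr_scaleC a0_simps zero_mem algebra_simps)

text \<open>Symmetry of \<open>a''\<close> is not part of its description. It is inherited in the
  limit, the quadratic expression being the limit of \<open>a\<close> at
  \<open>t *\<^sub>R \<theta>\<close> divided by t^2.\<close>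

lemma cquad_herm:
  assumes v: "v \<in> V0" "w \<in> V0"
  shows "cquad (a'' v w) \<theta> = cnj (cquad (a'' w v) \<theta>)"
proof -
  obtain t0 where t0: "0 < t0" "t0 \<le> 1" "\<And>t. 0 < t \<Longrightarrow> t \<le> t0 \<Longrightarrow> t *\<^sub>R \<theta> \<in> \<Theta>"
    using small_multiple_mem[of \<theta>] by blast
  let ?d = "norm (cquad (a'' v w) \<theta> - cnj (cquad (a'' w v) \<theta>))"
  have "?d \<le> 2 * Kq * (norm \<theta>)^3 * N v * N w * t" if t: "0 < t" "t \<le> t0" for t
  proof -
    note mem = t0(3)[OF t]
    let ?\<theta> = "t *\<^sub>R \<theta>"
    have h: "a ?\<theta> v w = cnj (a ?\<theta> w v)" by (rule form_herm[OF nonneg(1)[OF mem]])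
    have "t\<^sup>2 * ?d = norm (of_real (t\<^sup>2) * (cquad (a'' v w) \<theta> - cnj (cquad (a'' w v) \<theta>)))"
      by (simp only: norm_mult norm_of_real) simp
    also have "\<dots> = norm (cquad (a'' v w) ?\<theta> - cnj (cquad (a'' w v) ?\<theta>))"
      unfolding cquad_scaleR by (simp add: algebra_simps)
    also have "\<dots> = norm (cnj (a ?\<theta> w v - cquad (a'' w v) ?\<theta>) - (a ?\<theta> v w - cquad (a'' v w) ?\<theta>))"
      by (simp add: h)
    also have "\<dots> \<le> norm (a ?\<theta> w v - cquad (a'' w v) ?\<theta>) + norm (a ?\<theta> v w - cquad (a'' v w) ?\<theta>)"
      by (metis norm_triangle_ineq4 complex_mod_cnj)
    also have "\<dots> \<le> Kq * (norm ?\<theta>)^3 * N w * N v + Kq * (norm ?\<theta>)^3 * N v * N w"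
      by (intro add_mono Kq v mem)
    also have "\<dots> = t\<^sup>2 * (2 * Kq * (norm \<theta>)^3 * N v * N w * t)"
      using t by (simp add: power_mult_distrib algebra_simps power2_eq_square power3_eq_cube)
    finally show ?thesis using t by simp
  qed
  then have "?d \<le> 0" by (rule le_zero_if_le_linear[OF t0(1)])
  then show ?thesis by simp
qed

lemma hom_herm: "v \<in> V0 \<Longrightarrow> w \<in> V0 \<Longrightarrow> hom \<theta> v w = cnj (hom \<theta> w v)"
  using cquad_herm[of v w \<theta>] form_herm[OF nonneg(1)[OF zero_mem], of "corr \<theta> v" "corr \<theta> w"]
  by (simp add: hom_form_def)

lemma hom_bound:
  assumes v: "v \<in> V0" "w \<in> V0"
  shows "norm (hom \<theta> v w) \<le> (Cq + Cn\<^sup>2) * (norm \<theta>)\<^sup>2 * N v * N w"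
proof -
  have "norm (hom \<theta> v w) \<le> norm (cquad (a'' v w) \<theta>) + norm (a 0 (corr \<theta> v) (corr \<theta> w))"
    unfolding hom_form_def by (rule norm_triangle_ineq4)
  also have "norm (a 0 (corr \<theta> v) (corr \<theta> w)) \<le> N (corr \<theta> v) * N (corr \<theta> w)"
    by (rule a_bound_nrm[OF zero_mem])
  also have "\<dots> \<le> (Cn * norm \<theta> * N v) * (Cn * norm \<theta> * N w)"
    by (intro mult_mono corr_bound v mult_nonneg_nonneg) auto
  finally show ?thesis
    using cquad_bound[OF v, of \<theta>] by (simp add: algebra_simps power2_eq_square)
qed

section \<open>Transfer operators and coercivity of the homogenised form\<close>

lemma E_mem: "\<theta> \<in> \<Theta> \<Longrightarrow> v \<in> Vs \<Longrightarrow> E \<theta> v \<in> Vstar a Vs \<theta>"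
  using E_bij unfolding bij_betw_def by blast

lemma E_surj:
  assumes "\<theta> \<in> \<Theta>" "p \<in> Vstar a Vs \<theta>"
  obtains v where "v \<in> Vs" "p = E \<theta> v"
  using E_bij[OF assms(1)] assms(2) unfolding bij_betw_def by blast

lemma
  assumes \<theta>: "\<theta> \<in> \<Theta>"
  shows E_add: "v \<in> Vs \<Longrightarrow> w \<in> Vs \<Longrightarrow> E \<theta> (v + w) = E \<theta> v + E \<theta> w"
    and E_scaleC: "v \<in> Vs \<Longrightarrow> E \<theta> (c *\<^sub>C v) = c *\<^sub>C E \<theta> v"
    and E_zero: "E \<theta> 0 = 0"
proof -
  show add: "E \<theta> (v + w) = E \<theta> v + E \<theta> w" if "v \<in> Vs" "w \<in> Vs" for v w
    using E_lin[OF \<theta>] that unfolding clinear_on_def by blast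
  show "E \<theta> (c *\<^sub>C v) = c *\<^sub>C E \<theta> v" if "v \<in> Vs" for v
    using E_lin[OF \<theta>] that unfolding clinear_on_def by blast
  show "E \<theta> 0 = 0" using add[of 0 0] csubspace_zero[OF Vs] by simp
qed

lemma Vstar_subset: "p \<in> Vstar a Vs \<theta> \<Longrightarrow> p \<in> V a \<theta>"
  using Vs_subset by (auto simp: Vstar_def split: if_splits)

lemma Vstar_subspace: "\<theta> \<in> \<Theta> \<Longrightarrow> csubspace (Vstar a Vs \<theta>)"
  by (simp add: Vstar_def Vs V_subspace)

lemma
  assumes "\<theta> \<in> \<Theta>" "v \<in> Vs"
  shows a_E_left: "a \<theta> (E \<theta> v) u = 0" and a_E_right: "a \<theta> u (E \<theta> v) = 0"
  using a_V_left a_V_right Vstar_subset E_mem assms by blast+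

lemma Re_b0:
  assumes "x \<in> V0"
  shows "Re (b 0 x x) = (N x)\<^sup>2"
  using nrm_square[OF zero_mem, of x] a_V_left[OF zero_mem assms, of x] by (simp add: quad_def)

text \<open>The form \<open>a\<close> vanishes on both sides, so the norms reduce to
  \<open>b\<close>, which the transfer operators preserve.\<close>

lemma nrm_E:
  assumes \<theta>: "\<theta> \<in> \<Theta>" and v: "v \<in> Vs"
  shows "nrm a b \<theta> (E \<theta> v) = N v"
proof -
  have "(nrm a b \<theta> (E \<theta> v))\<^sup>2 = (N v)\<^sup>2"
    using nrm_square[OF \<theta>, of "E \<theta> v"] Re_b0[OF Vs_subset[OF v]]
    by (simp add: quad_def a_E_left[OF \<theta> v] E_iso[OF \<theta> v v])
  then show ?thesis using nrm_nonneg[OF \<theta>] by simp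
qed

text \<open>For \<theta> \<noteq> 0 the part of z + corr \<theta> z in \<open>V a \<theta>\<close>
  is close to \<open>Vs\<close>, and \<open>Z\<close> makes a positive angle with \<open>Vs\<close>;
  hence the part q in \<open>W a b \<theta>\<close> carries a fixed share of z, namely N z \<le> 2
  \<sigma> K |q|. Quadratic degeneracy on q bounds \<open>a \<theta>\<close> of the corrected vector
  from below, and \<open>hom_approx\<close> passes to the homogenised form with a cubic error. The
  smallness condition collects the distance from \<open>Vs\<close> and the size of the
  corrector.\<close>

lemma hom_coercive_small:
  assumes \<theta>: "\<theta> \<in> \<Theta>" "\<sigma> * (R * K * (1 + Cn * T) + Cn) * norm \<theta> \<le> 1 / 2" and z: "z \<in> Z"
  shows "\<gamma> / (4 * \<sigma>\<^sup>2 * K\<^sup>2) * (norm \<theta>)\<^sup>2 * (N z)\<^sup>2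
    \<le> Re (hom \<theta> z z) + (Ch + Cm * Cn) * (norm \<theta>)^3 * (N z)\<^sup>2"
proof (cases "\<theta> = 0")
  case True
  then show ?thesis
    using form_diag(2)[OF nonneg(1)[OF zero_mem]] hom_scaleR_arg[of z z 0 0] Z_subset[OF z] by simp
next
  case False
  let ?t = "norm \<theta>" and ?y = "z + corr \<theta> z"
  note zV = Z_subset[OF z]
  obtain p q where pq: "?y = p + q" "p \<in> V a \<theta>" "q \<in> W a b \<theta>"
    "nrm a b \<theta> p \<le> nrm a b \<theta> ?y"
    using orthogonal_split[OF \<theta>(1), of ?y] by metis
  obtain v where v: "v \<in> Vs" "N (p - v) \<le> R * ?t * nrm a b \<theta> p"
    using R(2)[OF \<theta>(1) zero_mem, of p] pq(2) False by (auto simp: Vstar_def)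
  have corr_le: "N (corr \<theta> z) \<le> Cn * ?t * N z" by (rule corr_bound[OF zV])
  have "nrm a b \<theta> p \<le> K * N ?y" using pq(4) nrm_le_N[OF \<theta>(1), of ?y] by linarith
  also have "\<dots> \<le> K * (N z + Cn * T * N z)"
  proof (rule mult_left_mono)
    have "Cn * ?t * N z \<le> Cn * T * N z" using T[OF \<theta>(1)] by (intro mult_right_mono mult_left_mono) auto
    then show "N ?y \<le> N z + Cn * T * N z" using N_triangle[of z "corr \<theta> z"] corr_le by linarith
  qed simp
  finally have "R * ?t * nrm a b \<theta> p \<le> R * ?t * (K * (N z + Cn * T * N z))"
    using R(1) by (intro mult_left_mono) auto
  then have pv: "N (p - v) \<le> R * ?t * (K * (N z + Cn * T * N z))" using v(2) by linarith
  \<comment> \<open>The left side has its \<open>Vs\<close> and \<open>Z\<close> components exposed,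
    so its norm controls N z; the right side is q up to terms with a factor |\<theta>|.\<close>
  have eq: "- v + z = (p - v) + q - corr \<theta> z" using pq(1) by (simp add: algebra_simps)
  have "N (- v + z) \<le> N (p - v) + N q + N (corr \<theta> z)"
    unfolding eq using N_triangle_diff[of "(p - v) + q" "corr \<theta> z"] N_triangle[of "p - v" q] by linarith
  also have "\<dots> \<le> R * ?t * (K * (N z + Cn * T * N z)) + K * nrm a b \<theta> q + Cn * ?t * N z"
    using pv N_le_nrm[OF \<theta>(1), of q] corr_le by linarith
  finally have "\<sigma> * N (- v + z)
    \<le> \<sigma> * (R * ?t * (K * (N z + Cn * T * N z)) + K * nrm a b \<theta> q + Cn * ?t * N z)"
    by (rule mult_left_mono) simp
  then have "N z \<le> \<sigma> * (R * ?t * (K * (N z + Cn * T * N z)) + K * nrm a b \<theta> q + Cn * ?t * N z)"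
    using N_right_le[OF csubspace_uminus[OF Vs v(1)] z] by linarith
  also have "\<dots> = \<sigma> * (R * K * (1 + Cn * T) + Cn) * ?t * N z + \<sigma> * K * nrm a b \<theta> q"
    by (simp add: algebra_simps)
  \<comment> \<open>Smallness of \<theta> makes the first term absorbable into the left
    side.\<close>
  also have "\<dots> \<le> 1 / 2 * N z + \<sigma> * K * nrm a b \<theta> q"
    using \<theta>(2) by (intro add_right_mono mult_right_mono) auto
  finally have "N z \<le> 2 * \<sigma> * K * nrm a b \<theta> q" by simp
  then have "(N z)\<^sup>2 \<le> (2 * \<sigma> * K * nrm a b \<theta> q)\<^sup>2" by (intro power_mono) auto
  then have "\<gamma> / (4 * \<sigma>\<^sup>2 * K\<^sup>2) * ?t\<^sup>2 * (N z)\<^sup>2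
    \<le> \<gamma> / (4 * \<sigma>\<^sup>2 * K\<^sup>2) * ?t\<^sup>2 * (2 * \<sigma> * K * nrm a b \<theta> q)\<^sup>2"
    using \<gamma>(1) by (intro mult_left_mono) auto
  also have "\<dots> = \<gamma> * ?t\<^sup>2 * (nrm a b \<theta> q)\<^sup>2"
    using \<sigma>_pos K(1) by (simp add: power_mult_distrib)
  also have "\<dots> \<le> quad (a \<theta>) q" by (rule \<gamma>(2)[OF \<theta>(1) pq(3)])
  also have "\<dots> = quad (a \<theta>) ?y"
    unfolding pq(1) quad_def
    by (simp add: a_simps \<theta>(1) a_V_left[OF \<theta>(1) pq(2)] a_V_right[OF \<theta>(1) pq(2)])
  also have "\<dots> = Re (a \<theta> ?y z) + Re (a \<theta> ?y (corr \<theta> z))"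
    unfolding quad_def form_add_right[OF nonneg(1)[OF \<theta>(1)], of ?y] by simp
  also have "Re (a \<theta> ?y (corr \<theta> z)) \<le> Cm * ?t\<^sup>2 * N z * N (corr \<theta> z)"
    using a_corrected_bound[OF \<theta>(1) zV, of "corr \<theta> z"] complex_Re_le_cmod order_trans by blast
  also have "\<dots> \<le> Cm * ?t\<^sup>2 * N z * (Cn * ?t * N z)"
    by (intro mult_left_mono corr_le) simp
  also have "Re (a \<theta> ?y z) \<le> Re (hom \<theta> z z) + Ch * ?t^3 * N z * N z"
    using hom_approx[OF \<theta>(1) zV zV] complex_Re_le_cmod[of "a \<theta> ?y z - hom \<theta> z z"] by simp
  finally show ?thesis by (simp add: algebra_simps power2_eq_square power3_eq_cube)
qed

definition cH :: real where "cH = \<gamma> / (4 * \<sigma>\<^sup>2 * K\<^sup>2)"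

lemma cH_pos: "0 < cH"
  using \<gamma> \<sigma>_pos K(1) by (simp add: cH_def)

text \<open>At \<open>t *\<^sub>R \<theta>\<close> the two main terms scale with t^2 and the error
  with t^3, so the error disappears as t tends to 0 and the bound holds for every \<theta>.\<close>

lemma hom_coercive:
  assumes z: "z \<in> Z"
  shows "cH * (norm \<theta>)\<^sup>2 * (N z)\<^sup>2 \<le> Re (hom \<theta> z z)"
proof -
  note zV = Z_subset[OF z]
  define G where "G = \<sigma> * (R * K * (1 + Cn * T) + Cn)"
  have G: "0 \<le> G" using R(1) T_nonneg by (simp add: G_def)
  obtain t0 where t0: "0 < t0" "t0 \<le> 1" "\<And>t. 0 < t \<Longrightarrow> t \<le> t0 \<Longrightarrow> t *\<^sub>R \<theta> \<in> \<Theta>"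
    using small_multiple_mem[of \<theta>] by blast
  \<comment> \<open>This choice enforces the smallness condition of
    \<open>hom_coercive_small\<close> along the ray.\<close>
  define t1 where "t1 = min t0 (1 / (2 * (G * norm \<theta> + 1)))"
  have G1: "0 < G * norm \<theta> + 1" using G by (simp add: add_nonneg_pos)
  have "cH * (norm \<theta>)\<^sup>2 * (N z)\<^sup>2 - Re (hom \<theta> z z) \<le> 0"
  proof (rule le_zero_if_le_linear)
    show "0 < t1" using t0(1) G1 by (simp add: t1_def)
    fix t assume t: "0 < t" "t \<le> t1"
    have mem: "t *\<^sub>R \<theta> \<in> \<Theta>" using t t0(3) by (simp add: t1_def)
    have "G * norm (t *\<^sub>R \<theta>) \<le> t * (G * norm \<theta> + 1)" using t by (simp add: algebra_simps)
    also have "\<dots> \<le> 1 / (2 * (G * norm \<theta> + 1)) * (G * norm \<theta> + 1)"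
      using t G1 by (intro mult_right_mono) (auto simp: t1_def)
    also have "\<dots> = 1 / 2" using G1 by simp
    finally have "cH * (norm (t *\<^sub>R \<theta>))\<^sup>2 * (N z)\<^sup>2
      \<le> Re (hom (t *\<^sub>R \<theta>) z z) + (Ch + Cm * Cn) * (norm (t *\<^sub>R \<theta>))^3 * (N z)\<^sup>2"
      unfolding cH_def G_def by (intro hom_coercive_small mem z)
    moreover have "Re (of_real r * x) = r * Re x" for r :: real and x by simp
    then have "Re (hom (t *\<^sub>R \<theta>) z z) = t\<^sup>2 * Re (hom \<theta> z z)"
      unfolding hom_scaleR_arg[OF zV zV] .
    ultimately have "t\<^sup>2 * (cH * (norm \<theta>)\<^sup>2 * (N z)\<^sup>2)
      \<le> t\<^sup>2 * (Re (hom \<theta> z z) + (Ch + Cm * Cn) * (norm \<theta>)^3 * (N z)\<^sup>2 * t)"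
      using t by (simp add: power_mult_distrib algebra_simps power2_eq_square power3_eq_cube)
    then have "cH * (norm \<theta>)\<^sup>2 * (N z)\<^sup>2
      \<le> Re (hom \<theta> z z) + (Ch + Cm * Cn) * (norm \<theta>)^3 * (N z)\<^sup>2 * t"
      using t by simp
    then show "cH * (norm \<theta>)\<^sup>2 * (N z)\<^sup>2 - Re (hom \<theta> z z)
      \<le> (Ch + Cm * Cn) * (norm \<theta>)^3 * (N z)\<^sup>2 * t" by simp
  qed
  then show ?thesis by simp
qed

section \<open>The homogenised problem\<close>

text \<open>The absolute value covers the trivial space, where the dual norm is a supremum over the
  empty set and may be negative. The final estimates contain only its square.\<close>

lemma dual_bound:
  assumes f: "antidual f" and \<theta>: "\<theta> \<in> \<Theta>"
  shows "norm (f u) \<le> \<bar>dual_nrm a b \<theta> f\<bar> * nrm a b \<theta> u"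
proof (cases "u = 0")
  case True
  have "f (0 + 0) = f 0 + f 0" using f unfolding antidual_def by blast
  then show ?thesis using True nrm_nonneg[OF \<theta>] by simp
next
  case False
  obtain M where M: "\<And>u. norm (f u) \<le> M * norm u" using antidual_bounded[OF f] by blast
  have pos: "0 < nrm a b \<theta> x" if "x \<noteq> 0" for x
    using nrm_equiv(1)[OF \<theta>, of x] that c0(1) K(1)
    by (smt (verit) divide_pos_pos mult_pos_pos zero_less_norm_iff)
  have "bdd_above ((\<lambda>x. norm (f x) / nrm a b \<theta> x) ` (UNIV - {0}))"
  proof (rule bdd_aboveI2)
    fix x :: 'h assume "x \<in> UNIV - {0}"
    then have x: "x \<noteq> 0" by simp
    have "norm (f x) \<le> \<bar>M\<bar> * norm x"
      using M[of x] mult_right_mono[OF abs_ge_self[of M] norm_ge_zero[of x]] by linarith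
    also have "norm x \<le> K / c0 * nrm a b \<theta> x"
      using nrm_equiv(1)[OF \<theta>, of x] c0(1) K(1) by (simp add: field_simps)
    finally have "norm (f x) \<le> \<bar>M\<bar> * (K / c0) * nrm a b \<theta> x"
      by (simp add: mult_left_mono)
    then show "norm (f x) / nrm a b \<theta> x \<le> \<bar>M\<bar> * (K / c0)"
      using pos[OF x] by (simp add: pos_divide_le_eq)
  qed
  then have "norm (f u) / nrm a b \<theta> u \<le> dual_nrm a b \<theta> f"
    unfolding dual_nrm_def using False by (intro cSUP_upper) auto
  then have "norm (f u) \<le> dual_nrm a b \<theta> f * nrm a b \<theta> u"
    using pos[OF False] by (simp add: pos_divide_le_eq)
  also have "\<dots> \<le> \<bar>dual_nrm a b \<theta> f\<bar> * nrm a b \<theta> u"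
    by (intro mult_right_mono nrm_nonneg[OF \<theta>]) simp
  finally show ?thesis .
qed

text \<open>The projection of \<open>V0\<close> onto \<open>Z\<close> along \<open>Vs\<close>. It
  turns a problem for the pair (v, z) into one for the sum v + z.\<close>

definition Zpart :: "'h \<Rightarrow> 'h" where
  "Zpart x = (SOME z. z \<in> Z \<and> x - z \<in> Vs)"

lemma Zpart_sum:
  assumes "v \<in> Vs" "z \<in> Z"
  shows "Zpart (v + z) = z"
  unfolding Zpart_def
proof (rule some_equality)
  show "z \<in> Z \<and> v + z - z \<in> Vs" using assms by simp
  show "z' = z" if "z' \<in> Z \<and> v + z - z' \<in> Vs" for z'
    using V0_unique(2)[of "v + z - z'" z' v z] that assms by simp
qed

lemma
  assumes "x \<in> V0"
  shows Zpart_mem: "Zpart x \<in> Z" and Zpart_compl: "x - Zpart x \<in> Vs"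
  using V0_decompose[OF assms] Zpart_sum by (metis add_diff_cancel_right')+

lemma Zpart_V0: "x \<in> V0 \<Longrightarrow> Zpart x \<in> V0"
  by (rule Z_subset[OF Zpart_mem])

lemma
  assumes x: "x \<in> V0"
  shows Zpart_add: "w \<in> V0 \<Longrightarrow> Zpart (x + w) = Zpart x + Zpart w"
    and Zpart_scaleC: "Zpart (c *\<^sub>C x) = c *\<^sub>C Zpart x"
proof -
  show "Zpart (x + w) = Zpart x + Zpart w" if w: "w \<in> V0"
    using Zpart_sum[OF csubspace_add[OF Vs Zpart_compl[OF x] Zpart_compl[OF w]]
        csubspace_add[OF Z Zpart_mem[OF x] Zpart_mem[OF w]]]
    by (simp add: algebra_simps)
  show "Zpart (c *\<^sub>C x) = c *\<^sub>C Zpart x"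
    using Zpart_sum[OF csubspace_scaleC[OF Vs Zpart_compl[OF x], of c] csubspace_scaleC[OF Z Zpart_mem[OF x], of c]]
    by (simp flip: scaleC_add_right)
qed

lemma
  assumes x: "x \<in> V0"
  shows N_Zpart: "N (Zpart x) \<le> \<sigma> * N x" and N_Zcompl: "N (x - Zpart x) \<le> \<sigma> * N x"
  using N_left_le[OF Zpart_compl[OF x] Zpart_mem[OF x]]
    N_right_le[OF Zpart_compl[OF x] Zpart_mem[OF x]] by simp_all

text \<open>Written for x = v + z the problem is one equation on \<open>V0\<close>. Its form is
  coercive because the homogenised form is non-negative on \<open>Z\<close> and \<open>b 0\<close>
  is the squared norm \<open>N\<close> on \<open>V0\<close>; directness of the sum turns uniqueness
  of x into uniqueness of the pair.\<close>

lemma hom_solvable: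
  assumes f: "antidual f" and \<theta>: "\<theta> \<in> \<Theta>"
  shows "\<exists>!(v, z). solves_hom a b a' a'' Vs Z E f \<theta> \<epsilon> v z"
proof -
  let ?\<theta> = "(1 / \<epsilon>) *\<^sub>R \<theta>" and ?F = "\<bar>dual_nrm a b \<theta> f\<bar>"
  let ?H = "(Cq + Cn\<^sup>2) * (norm ?\<theta>)\<^sup>2"
  define B where "B x w = hom ?\<theta> (Zpart x) (Zpart w) + b 0 x w" for x w
  define g where "g w = f (E \<theta> (w - Zpart w) + Zpart w)" for w
  have f_add: "f (x + y) = f x + f y" and f_scale: "f (c *\<^sub>C x) = cnj c * f x" for x y c
    using f by (auto simp: antidual_def)
  note hs = sesq_simps[OF hom_sesq V0_subspace V0_subspace]
  have "\<exists>!x. x \<in> V0 \<and> (\<forall>w\<in>V0. B x w = g w)"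
  proof (rule riesz_form[OF V0_subspace V_closed[OF zero_mem], where c = "c0\<^sup>2"
      and C = "(\<bar>?H\<bar> * \<sigma>\<^sup>2 + 1) * C0\<^sup>2" and M = "?F * (\<sigma> + K * \<sigma>) * C0"])
    show "sesquilinear_on V0 V0 B"
      unfolding sesquilinear_on_def B_def
      by (simp add: Zpart_add Zpart_scaleC hs Zpart_V0 b0_simps algebra_simps)
    show "B x w = cnj (B w x)" if "x \<in> V0" "w \<in> V0" for x w
      unfolding B_def using hom_herm[OF Zpart_V0[OF that(1)] Zpart_V0[OF that(2)], of ?\<theta>]
        form_herm[OF nonneg(2)[OF zero_mem], of x w] by simp
    show "0 < c0\<^sup>2" using c0 by simp
    show "c0\<^sup>2 * (norm x)\<^sup>2 \<le> Re (B x x)" if x: "x \<in> V0" for x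
    proof -
      have "0 \<le> cH * (norm ?\<theta>)\<^sup>2 * (N (Zpart x))\<^sup>2" using cH_pos by simp
      then have "0 \<le> Re (hom ?\<theta> (Zpart x) (Zpart x))"
        using hom_coercive[OF Zpart_mem[OF x], of ?\<theta>] by linarith
      moreover have "(c0 * norm x)\<^sup>2 \<le> (N x)\<^sup>2" using c0 by (intro power_mono) auto
      ultimately show ?thesis by (simp add: B_def Re_b0[OF x] power_mult_distrib)
    qed
    show "norm (B x w) \<le> (\<bar>?H\<bar> * \<sigma>\<^sup>2 + 1) * C0\<^sup>2 * norm x * norm w" if x: "x \<in> V0" "w \<in> V0" for x w
    proof -
      have "norm (hom ?\<theta> (Zpart x) (Zpart w)) \<le> ?H * (N (Zpart x) * N (Zpart w))"
        using hom_bound[OF Zpart_V0[OF x(1)] Zpart_V0[OF x(2)], of ?\<theta>] by (simp add: mult_ac)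
      also have "\<dots> \<le> \<bar>?H\<bar> * (N (Zpart x) * N (Zpart w))" by (intro mult_right_mono) auto
      also have "\<dots> \<le> \<bar>?H\<bar> * ((\<sigma> * N x) * (\<sigma> * N w))"
        by (intro mult_left_mono mult_mono N_Zpart x) auto
      finally have "norm (hom ?\<theta> (Zpart x) (Zpart w)) \<le> \<bar>?H\<bar> * ((\<sigma> * N x) * (\<sigma> * N w))" .
      then have "norm (B x w) \<le> \<bar>?H\<bar> * ((\<sigma> * N x) * (\<sigma> * N w)) + N x * N w"
        unfolding B_def
        using norm_triangle_ineq[of "hom ?\<theta> (Zpart x) (Zpart w)" "b 0 x w"] b_bound_nrm[OF zero_mem, of x w]
        by linarith
      also have "\<dots> = (\<bar>?H\<bar> * \<sigma>\<^sup>2 + 1) * (N x * N w)"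
        by (simp add: algebra_simps power2_eq_square)
      also have "\<dots> \<le> (\<bar>?H\<bar> * \<sigma>\<^sup>2 + 1) * ((C0 * norm x) * (C0 * norm w))"
        using C0 by (intro mult_left_mono mult_mono) auto
      finally show ?thesis by (simp add: algebra_simps power2_eq_square)
    qed
    show "g (x + w) = g x + g w" if "x \<in> V0" "w \<in> V0" for x w
    proof -
      have "x + w - Zpart (x + w) = (x - Zpart x) + (w - Zpart w)"
        using that by (simp add: Zpart_add)
      then have "E \<theta> (x + w - Zpart (x + w)) = E \<theta> (x - Zpart x) + E \<theta> (w - Zpart w)"
        using that by (simp only: E_add[OF \<theta> Zpart_compl Zpart_compl])
      then show ?thesis
        using that by (simp add: g_def Zpart_add f_add)
    qed
    show "g (c *\<^sub>C x) = cnj c * g x" if "x \<in> V0" for c x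
    proof -
      have "c *\<^sub>C x - Zpart (c *\<^sub>C x) = c *\<^sub>C (x - Zpart x)"
        using that by (simp add: Zpart_scaleC scaleC_diff_right)
      then have "E \<theta> (c *\<^sub>C x - Zpart (c *\<^sub>C x)) = c *\<^sub>C E \<theta> (x - Zpart x)"
        using that by (simp only: E_scaleC[OF \<theta> Zpart_compl])
      then show ?thesis
        using that by (simp add: g_def Zpart_scaleC f_add f_scale distrib_left)
    qed
    show "norm (g x) \<le> ?F * (\<sigma> + K * \<sigma>) * C0 * norm x" if x: "x \<in> V0" for x
    proof -
      have "nrm a b \<theta> (E \<theta> (x - Zpart x) + Zpart x) \<le> N (x - Zpart x) + K * N (Zpart x)"
        using nrm_triangle[OF \<theta>, of "E \<theta> (x - Zpart x)" "Zpart x"] nrm_E[OF \<theta> Zpart_compl[OF x]]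
          nrm_le_N[OF \<theta>, of "Zpart x"] by linarith
      also have "\<dots> \<le> \<sigma> * N x + K * (\<sigma> * N x)"
        by (intro add_mono mult_left_mono N_Zpart N_Zcompl x) auto
      also have "\<dots> = (\<sigma> + K * \<sigma>) * N x" by (simp add: algebra_simps)
      also have "\<dots> \<le> (\<sigma> + K * \<sigma>) * (C0 * norm x)" using C0 by (intro mult_left_mono) auto
      finally have "?F * nrm a b \<theta> (E \<theta> (x - Zpart x) + Zpart x) \<le> ?F * ((\<sigma> + K * \<sigma>) * (C0 * norm x))"
        by (rule mult_left_mono) simp
      then show ?thesis
        using dual_bound[OF f \<theta>, of "E \<theta> (x - Zpart x) + Zpart x"] by (simp add: g_def mult_ac)
    qed
  qed
  then obtain x where x: "x \<in> V0" "\<And>w. w \<in> V0 \<Longrightarrow> B x w = g w"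
    and uniq: "\<And>y. y \<in> V0 \<Longrightarrow> (\<And>w. w \<in> V0 \<Longrightarrow> B y w = g w) \<Longrightarrow> y = x"
    by metis
  \<comment> \<open>On decomposed vectors both sides become those of the homogenised
    equation.\<close>
  have eqs: "B (v + z) (v' + z') = hom ?\<theta> z z' + b 0 (v + z) (v' + z')"
    "g (v' + z') = f (E \<theta> v' + z')" if "v \<in> Vs" "z \<in> Z" "v' \<in> Vs" "z' \<in> Z" for v z v' z'
    using that by (simp_all add: B_def g_def Zpart_sum)
  obtain v z where vz: "v \<in> Vs" "z \<in> Z" "x = v + z" by (rule V0_decompose[OF x(1)])
  have solves_iff: "solves_hom a b a' a'' Vs Z E f \<theta> \<epsilon> v1 z1
    \<longleftrightarrow> v1 \<in> Vs \<and> z1 \<in> Z \<and> (\<forall>w\<in>V0. B (v1 + z1) w = g w)" for v1 z1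
    unfolding solves_hom_def using eqs by (metis V0_add V0_decompose)
  show ?thesis
  proof (rule ex1I[of _ "(v, z)"])
    show "case (v, z) of (v, z) \<Rightarrow> solves_hom a b a' a'' Vs Z E f \<theta> \<epsilon> v z"
      using vz x by (simp add: solves_iff)
    show "vz' = (v, z)" if "case vz' of (v, z) \<Rightarrow> solves_hom a b a' a'' Vs Z E f \<theta> \<epsilon> v z" for vz'
    proof -
      obtain v1 z1 where e: "vz' = (v1, z1)" by force
      have s: "v1 \<in> Vs" "z1 \<in> Z" "\<forall>w\<in>V0. B (v1 + z1) w = g w"
        using that by (auto simp: e solves_iff)
      then have "v1 + z1 = v + z" using uniq[OF V0_add[OF s(1,2)]] vz(3) by blast
      then show ?thesis using V0_unique[OF s(1,2) vz(1,2)] e by simp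
    qed
  qed
qed

text \<open>Testing with the solution itself bounds N (v + z). Testing with z alone brings in
  coercivity with the weight |\<theta>|^2 / \<epsilon>^2, which gives the bound of order
  \<epsilon>^2; the bound of order \<epsilon> is the geometric mean of the other two bounds for
  z.\<close>

lemma hom_estimates:
  obtains C where "0 \<le> C"
    "\<And>\<theta> \<epsilon> F f v z. \<theta> \<in> \<Theta> \<Longrightarrow> 0 < \<epsilon> \<Longrightarrow> 0 \<le> F \<Longrightarrow> (\<And>u. norm (f u) \<le> F * nrm a b \<theta> u) \<Longrightarrow>
      solves_hom a b a' a'' Vs Z E f \<theta> \<epsilon> v z \<Longrightarrow>
      N v \<le> C * F \<and> N z \<le> C * F \<and> norm \<theta> * N z \<le> C * \<epsilon> * F \<and> (norm \<theta>)\<^sup>2 * N z \<le> C * \<epsilon>\<^sup>2 * F"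
proof -
  define D where "D = \<sigma> + K * \<sigma>"
  define C1 where "C1 = \<sigma> * D"
  define C2 where "C2 = (K + D) / cH"
  define C where "C = C1 + C2"
  have D: "0 \<le> D" by (simp add: D_def)
  have C1: "0 \<le> C1" using D by (simp add: C1_def)
  have C2: "0 \<le> C2" using D cH_pos by (simp add: C2_def)
  show ?thesis
  proof (rule that[of C])
    show "0 \<le> C" using C1 C2 by (simp add: C_def)
    fix \<theta> \<epsilon> F f v z
    assume \<theta>: "\<theta> \<in> \<Theta>" and \<epsilon>: "0 < \<epsilon>" and F: "0 \<le> F" "\<And>u. norm (f u) \<le> F * nrm a b \<theta> u"
      and sol: "solves_hom a b a' a'' Vs Z E f \<theta> \<epsilon> v z"
    let ?\<theta> = "(1 / \<epsilon>) *\<^sub>R \<theta>" and ?x = "v + z"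
    have v: "v \<in> Vs" and z: "z \<in> Z"
      and eq: "\<And>v' z'. v' \<in> Vs \<Longrightarrow> z' \<in> Z \<Longrightarrow> hom ?\<theta> z z' + b 0 ?x (v' + z') = f (E \<theta> v' + z')"
      using sol unfolding solves_hom_def by auto
    note xV = V0_add[OF v z] and split = N_left_le[OF v z] N_right_le[OF v z]
    have coer: "cH * (norm ?\<theta>)\<^sup>2 * (N z)\<^sup>2 \<le> Re (hom ?\<theta> z z)" by (rule hom_coercive[OF z])
    have "0 \<le> cH * (norm ?\<theta>)\<^sup>2 * (N z)\<^sup>2" using cH_pos by simp
    then have "(N ?x)\<^sup>2 \<le> Re (hom ?\<theta> z z + b 0 ?x ?x)"
      using coer Re_b0[OF xV] by simp
    also have "\<dots> \<le> norm (f (E \<theta> v + z))"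
      unfolding eq[OF v z] by (rule complex_Re_le_cmod)
    also have "\<dots> \<le> F * nrm a b \<theta> (E \<theta> v + z)" by (rule F)
    also have "\<dots> \<le> F * (N v + K * N z)"
      using nrm_triangle[OF \<theta>, of "E \<theta> v" z] nrm_E[OF \<theta> v] nrm_le_N[OF \<theta>, of z]
      by (intro mult_left_mono F(1)) linarith
    also have "\<dots> \<le> F * (\<sigma> * N ?x + K * (\<sigma> * N ?x))"
      by (intro mult_left_mono add_mono split F(1)) simp
    also have "\<dots> = D * F * N ?x" by (simp add: D_def algebra_simps)
    finally have "(N ?x)\<^sup>2 \<le> D * F * N ?x" .
    then have x_le: "N ?x \<le> D * F"
      using D F(1) by (cases "N ?x = 0") (auto simp: power2_eq_square order_less_le)
    have "\<sigma> * N ?x \<le> \<sigma> * (D * F)" by (intro mult_left_mono x_le) simp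
    then have vz: "N v \<le> C1 * F" "N z \<le> C1 * F"
      using split by (simp_all add: C1_def mult.assoc)
    have "cH * (norm ?\<theta>)\<^sup>2 * (N z)\<^sup>2 \<le> norm (hom ?\<theta> z z)"
      using coer complex_Re_le_cmod[of "hom ?\<theta> z z"] by linarith
    \<comment> \<open>The test pair is (0, z), so that every term on the right has a factor N z to
      cancel.\<close>
    also have "hom ?\<theta> z z = f z - b 0 ?x z"
      using eq[OF csubspace_zero[OF Vs] z] by (simp add: E_zero[OF \<theta>] algebra_simps)
    also have "norm (f z - b 0 ?x z) \<le> norm (f z) + norm (b 0 ?x z)" by (rule norm_triangle_ineq4)
    also have "\<dots> \<le> F * (K * N z) + D * F * N z"
    proof (rule add_mono)
      show "norm (f z) \<le> F * (K * N z)"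
        using F(2)[of z] mult_left_mono[OF nrm_le_N[OF \<theta>, of z] F(1)] by linarith
      show "norm (b 0 ?x z) \<le> D * F * N z"
        using b_bound_nrm[OF zero_mem, of ?x z] mult_right_mono[OF x_le, of "N z"] by simp
    qed
    finally have "cH * (norm ?\<theta>)\<^sup>2 * (N z)\<^sup>2 \<le> (K + D) * F * N z" by (simp add: algebra_simps)
    then have "cH * (norm ?\<theta>)\<^sup>2 * N z * N z \<le> (K + D) * F * N z"
      by (simp add: power2_eq_square mult.assoc)
    then have "cH * (norm ?\<theta>)\<^sup>2 * N z \<le> (K + D) * F"
    proof (cases "N z = 0")
      case False
      then have "0 < N z" by (simp add: order_less_le)
      then show ?thesis
        using mult_right_le_imp_le[OF \<open>cH * (norm ?\<theta>)\<^sup>2 * N z * N z \<le> (K + D) * F * N z\<close>] by blast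
    qed (use D F(1) in simp)
    moreover have "(norm ?\<theta>)\<^sup>2 = (norm \<theta>)\<^sup>2 / \<epsilon>\<^sup>2" using \<epsilon> by (simp add: power_divide)
    ultimately have sq: "(norm \<theta>)\<^sup>2 * N z \<le> C2 * \<epsilon>\<^sup>2 * F"
      using \<epsilon> cH_pos by (simp add: C2_def field_simps)
    \<comment> \<open>Interpolation between the bounds for N z and for |\<theta>|^2 N z.\<close>
    have "(norm \<theta> * N z)\<^sup>2 = ((norm \<theta>)\<^sup>2 * N z) * N z" by (simp add: power2_eq_square)
    also have "\<dots> \<le> (C2 * \<epsilon>\<^sup>2 * F) * (C1 * F)"
      using C2 F(1) by (intro mult_mono sq vz(2)) auto
    also have "\<dots> \<le> (C * \<epsilon> * F)\<^sup>2"
    proof -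
      have "C2 * C1 \<le> C * C" using C1 C2 by (intro mult_mono) (auto simp: C_def)
      then have "C2 * C1 * (\<epsilon> * F)\<^sup>2 \<le> C * C * (\<epsilon> * F)\<^sup>2" by (intro mult_right_mono) auto
      then show ?thesis by (simp add: power2_eq_square mult_ac)
    qed
    finally have lin: "norm \<theta> * N z \<le> C * \<epsilon> * F"
      by (rule power2_le_imp_le) (use C1 C2 F(1) \<epsilon> in \<open>simp add: C_def\<close>)
    have "C1 * F \<le> C * F" "C2 * \<epsilon>\<^sup>2 * F \<le> C * \<epsilon>\<^sup>2 * F"
      using C1 C2 F(1) by (auto simp: C_def intro!: mult_right_mono)
    then show "N v \<le> C * F \<and> N z \<le> C * F \<and> norm \<theta> * N z \<le> C * \<epsilon> * F \<and> (norm \<theta>)\<^sup>2 * N z \<le> C * \<epsilon>\<^sup>2 * F"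
      using vz sq lin by linarith
  qed
qed

section \<open>Error estimates\<close>

text \<open>On the component x in \<open>V0\<close> the form is of size |\<theta>|^2, so the assumed
  bound on |\<theta>| N (x + w) controls its seminorm, and by the triangle inequality that of w.
  Passing from \<open>a \<theta>\<close> to \<open>a 0\<close> costs L |\<theta>| (N w)^2, where one
  factor |\<theta>| N w is again controlled; the spectral gap at 0 then bounds N w with no factor
  |\<theta>|.\<close>

lemma W0_component_bound:
  assumes D: "0 \<le> D"
  obtains C where "0 \<le> C"
    "\<And>\<theta> x w. \<theta> \<in> \<Theta> \<Longrightarrow> x \<in> V0 \<Longrightarrow> w \<in> W a b 0 \<Longrightarrow> N x \<le> N (x + w) \<Longrightarrow> N w \<le> N (x + w) \<Longrightarrow>
      norm \<theta> * N (x + w) \<le> D * form_norm (a \<theta>) (x + w) \<Longrightarrow> N w \<le> C * form_norm (a \<theta>) (x + w)"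
proof -
  \<comment> \<open>\<open>H\<close> times |\<theta>| N x will bound the seminorm of x; T turns the
    cubic error into a quadratic one.\<close>
  define H where "H = sqrt (\<bar>Cq\<bar> + Kq * T)"
  define A where "A = 1 + H * D"
  define C where "C = 1 + (A\<^sup>2 + L * D) / \<nu>"
  have H2: "H\<^sup>2 = \<bar>Cq\<bar> + Kq * T" and H: "0 \<le> H" using Kq T_nonneg by (auto simp: H_def)
  have CR: "0 \<le> (A\<^sup>2 + L * D) / \<nu>" using L(1) D \<nu>(1) by simp
  show ?thesis
  proof (rule that[of C])
    show "0 \<le> C" using CR by (simp add: C_def)
    fix \<theta> x w
    assume \<theta>: "\<theta> \<in> \<Theta>" and x: "x \<in> V0" and w: "w \<in> W a b 0"
      and le: "N x \<le> N (x + w)" "N w \<le> N (x + w)"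
      and deg: "norm \<theta> * N (x + w) \<le> D * form_norm (a \<theta>) (x + w)"
    let ?t = "norm \<theta>"
    define s where "s = form_norm (a \<theta>) (x + w)"
    have s0: "0 \<le> s" unfolding s_def by (rule form_norm_ge_zero[OF nonneg(1)[OF \<theta>]])
    have tx: "?t * N x \<le> D * s" and tw: "?t * N w \<le> D * s"
      using mult_left_mono[OF le(1) norm_ge_zero[of \<theta>]] mult_left_mono[OF le(2) norm_ge_zero[of \<theta>]] deg
      unfolding s_def by linarith+
    have "(form_norm (a \<theta>) x)\<^sup>2 \<le> norm (a \<theta> x x)"
      unfolding form_norm_square[OF nonneg(1)[OF \<theta>]] quad_def by (rule complex_Re_le_cmod)
    also have "\<dots> \<le> norm (cquad (a'' x x) \<theta>) + norm (a \<theta> x x - cquad (a'' x x) \<theta>)"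
      by (rule norm_triangle_sub)
    also have "\<dots> \<le> Cq * ?t\<^sup>2 * N x * N x + Kq * ?t^3 * N x * N x"
      by (intro add_mono cquad_bound Kq x \<theta>)
    also have "\<dots> = (Cq + Kq * ?t) * (?t * N x)\<^sup>2"
      by (simp add: algebra_simps power2_eq_square power3_eq_cube)
    also have "\<dots> \<le> (\<bar>Cq\<bar> + Kq * T) * (?t * N x)\<^sup>2"
      using T[OF \<theta>] Kq(1) by (intro mult_right_mono add_mono mult_left_mono) auto
    also have "\<dots> = (H * (?t * N x))\<^sup>2" by (simp add: H2[symmetric] power_mult_distrib)
    finally have "form_norm (a \<theta>) x \<le> H * (?t * N x)" by (rule power2_le_imp_le) (simp add: H)
    also have "\<dots> \<le> H * (D * s)" by (intro mult_left_mono tx H)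
    finally have ax: "form_norm (a \<theta>) x \<le> H * (D * s)" .
    have "form_norm (a \<theta>) w \<le> A * s"
      using form_norm_triangle_diff[OF nonneg(1)[OF \<theta>], of "x + w" x] ax
      by (simp add: A_def s_def algebra_simps)
    then have "quad (a \<theta>) w \<le> (A * s)\<^sup>2"
      using form_norm_square[OF nonneg(1)[OF \<theta>]] form_norm_ge_zero[OF nonneg(1)[OF \<theta>]] power_mono
      by metis
    moreover have "quad (a 0) w \<le> quad (a \<theta>) w + L * ?t * N w * N w"
      using L(2)[OF \<theta>, of w w] abs_Re_le_cmod[of "a \<theta> w w - a 0 w w"] by (simp add: quad_def)
    moreover have "L * N w * (?t * N w) \<le> L * N w * (D * s)"
      using L(1) by (intro mult_left_mono tw) auto
    ultimately have main: "\<nu> * (N w)\<^sup>2 \<le> A\<^sup>2 * (s * s) + L * D * s * N w"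
      using \<nu>(2)[OF w] by (simp add: power2_eq_square mult_ac)
    \<comment> \<open>The quadratic inequality is solved by cases: either N w \<le> s already, or
      one s in s * s may be replaced by N w and N w cancelled.\<close>
    have "N w \<le> C * s"
    proof (cases "N w \<le> s")
      case True
      have "1 * s \<le> C * s" using CR s0 by (intro mult_right_mono) (auto simp: C_def)
      then show ?thesis using True by simp
    next
      case False
      have "A\<^sup>2 * (s * s) \<le> A\<^sup>2 * (s * N w)" using False s0 by (intro mult_left_mono) auto
      then have "N w * (\<nu> * N w) \<le> N w * ((A\<^sup>2 + L * D) * s)"
        using main by (simp add: algebra_simps power2_eq_square)
      then have "\<nu> * N w \<le> (A\<^sup>2 + L * D) * s" using False s0 by simp
      then have "N w \<le> (A\<^sup>2 + L * D) / \<nu> * s" using \<nu>(1) by (simp add: field_simps)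
      then show ?thesis using s0 by (simp add: C_def distrib_right)
    qed
    then show "N w \<le> C * form_norm (a \<theta>) (x + w)" by (simp add: s_def)
  qed
qed

text \<open>For \<open>\<theta> = 0\<close>, where \<open>Vs\<close> may be smaller than \<open>V a 0\<close>, no orthogonality is needed: \<open>p = 0\<close> and
  \<open>q = w\<close> will do, as the last estimate has the factor \<open>norm \<theta> = 0\<close>.\<close>

lemma degenerate_split:
  assumes \<theta>: "\<theta> \<in> \<Theta>"
  obtains p q where "w = p + q" "p \<in> Vstar a Vs \<theta>" "nrm a b \<theta> p \<le> nrm a b \<theta> w" "nrm a b \<theta> q \<le> nrm a b \<theta> w"
    "form_norm (a \<theta>) q = form_norm (a \<theta>) w" "norm \<theta> * N q \<le> K / sqrt \<gamma> * form_norm (a \<theta>) w"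
proof (cases "\<theta> = 0")
  case True
  show ?thesis
  proof (rule that[of 0 w])
    show "0 \<in> Vstar a Vs \<theta>" by (rule csubspace_zero[OF Vstar_subspace[OF \<theta>]])
    show "nrm a b \<theta> 0 \<le> nrm a b \<theta> w"
      using nrm_nonneg[OF \<theta>] by (simp add: nrm_eq_form_norm form_norm_zero ip_nonneg \<theta>)
    show "norm \<theta> * N w \<le> K / sqrt \<gamma> * form_norm (a \<theta>) w"
      using True \<gamma>(1) form_norm_ge_zero[OF nonneg(1)[OF \<theta>]] by simp
  qed simp_all
next
  case False
  obtain p q where pq: "w = p + q" "p \<in> V a \<theta>" "q \<in> W a b \<theta>"
    "nrm a b \<theta> p \<le> nrm a b \<theta> w" "nrm a b \<theta> q \<le> nrm a b \<theta> w"
    by (rule orthogonal_split[OF \<theta>, of w])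
  have eq: "form_norm (a \<theta>) q = form_norm (a \<theta>) w"
    unfolding pq(1) form_norm_def quad_def
    by (simp add: a_simps \<theta> a_V_left[OF \<theta> pq(2)] a_V_right[OF \<theta> pq(2)])
  have "(norm \<theta> * nrm a b \<theta> q)\<^sup>2 * \<gamma> \<le> (form_norm (a \<theta>) q)\<^sup>2"
    using \<gamma>(2)[OF \<theta> pq(3)] by (simp add: form_norm_square nonneg \<theta> power_mult_distrib mult_ac)
  then have "sqrt ((norm \<theta> * nrm a b \<theta> q)\<^sup>2 * \<gamma>) \<le> sqrt ((form_norm (a \<theta>) q)\<^sup>2)"
    by (rule real_sqrt_le_mono)
  then have "norm \<theta> * nrm a b \<theta> q * sqrt \<gamma> \<le> form_norm (a \<theta>) w"
    using nrm_nonneg[OF \<theta>] form_norm_ge_zero[OF nonneg(1)[OF \<theta>]] eq by (simp add: real_sqrt_mult)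
  then have "norm \<theta> * nrm a b \<theta> q \<le> form_norm (a \<theta>) w / sqrt \<gamma>"
    using \<gamma>(1) by (simp add: pos_le_divide_eq)
  then have "K * (norm \<theta> * nrm a b \<theta> q) \<le> K * (form_norm (a \<theta>) w / sqrt \<gamma>)"
    by (rule mult_left_mono) simp
  moreover have "norm \<theta> * N q \<le> norm \<theta> * (K * nrm a b \<theta> q)"
    by (intro mult_left_mono N_le_nrm \<theta>) simp
  ultimately have "norm \<theta> * N q \<le> K / sqrt \<gamma> * form_norm (a \<theta>) w" by (simp add: mult_ac)
  then show ?thesis
    using that[of p q] pq eq False by (simp add: Vstar_def)
qed

text \<open>Splitting at \<theta> leaves a part q with |\<theta>| N q controlled, and splitting q at
  0 gives \<open>v1\<close>, z and a \<open>W a b 0\<close> part. The vector \<open>v1\<close> lies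
  in \<open>Vs\<close>, not in the range of \<open>E \<theta>\<close>; moving it to a near point
  \<open>v2\<close> there costs R |\<theta>| N v1, which is controlled too and goes into r.\<close>

lemma test_decomposition:
  obtains C where "0 \<le> C"
    "\<And>\<theta> w. \<theta> \<in> \<Theta> \<Longrightarrow> \<exists>v\<in>Vs. \<exists>z\<in>Z. \<exists>r. w = E \<theta> v + z + r \<and> N v \<le> C * nrm a b \<theta> w \<and>
      norm \<theta> * N z \<le> C * form_norm (a \<theta>) w \<and> N r \<le> C * form_norm (a \<theta>) w"
proof -
  define D where "D = K / sqrt \<gamma>"
  have D: "0 \<le> D" using \<gamma>(1) by (simp add: D_def)
  obtain C1 where C1: "0 \<le> C1"
    "\<And>\<theta> x w. \<theta> \<in> \<Theta> \<Longrightarrow> x \<in> V0 \<Longrightarrow> w \<in> W a b 0 \<Longrightarrow> N x \<le> N (x + w) \<Longrightarrow> N w \<le> N (x + w) \<Longrightarrow>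
      norm \<theta> * N (x + w) \<le> D * form_norm (a \<theta>) (x + w) \<Longrightarrow> N w \<le> C1 * form_norm (a \<theta>) (x + w)"
    using W0_component_bound[OF D] by blast
  define A1 where "A1 = 1 + (K + R * T) * (\<sigma> * K)"
  define A2 where "A2 = \<sigma> * D"
  define A3 where "A3 = C1 + K * R * A2"
  have A: "0 \<le> A1" "0 \<le> A2" "0 \<le> A3"
    using D C1(1) R(1) T_nonneg by (auto simp: A1_def A2_def A3_def)
  show ?thesis
  proof (rule that[of "A1 + A2 + A3"])
    show "0 \<le> A1 + A2 + A3" using A by simp
    fix \<theta> w assume \<theta>: "\<theta> \<in> \<Theta>"
    let ?t = "norm \<theta>"
    define s where "s = form_norm (a \<theta>) w"
    have s0: "0 \<le> s" unfolding s_def by (rule form_norm_ge_zero[OF nonneg(1)[OF \<theta>]])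
    have w0: "0 \<le> nrm a b \<theta> w" by (rule nrm_nonneg[OF \<theta>])
    obtain p q where pq: "w = p + q" "p \<in> Vstar a Vs \<theta>" "nrm a b \<theta> p \<le> nrm a b \<theta> w"
      "nrm a b \<theta> q \<le> nrm a b \<theta> w" "form_norm (a \<theta>) q = s" "?t * N q \<le> D * s"
      unfolding s_def D_def by (rule degenerate_split[OF \<theta>, of w])
    obtain x y where xy: "q = x + y" "x \<in> V0" "y \<in> W a b 0" "N x \<le> N q" "N y \<le> N q"
      by (rule orthogonal_split[OF zero_mem, of q])
    obtain v1 z where vz: "v1 \<in> Vs" "z \<in> Z" "x = v1 + z" by (rule V0_decompose[OF xy(2)])
    obtain v2 where v2: "v2 \<in> Vstar a Vs \<theta>" "nrm a b \<theta> (v1 - v2) \<le> R * ?t * N v1"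
      using R(2)[OF zero_mem \<theta>, of v1] vz(1) by (auto simp: Vstar_def)
    \<comment> \<open>Surjectivity of \<open>E \<theta>\<close> gathers both kernel contributions
      into one image.\<close>
    obtain v where v: "v \<in> Vs" "p + v2 = E \<theta> v"
      by (rule E_surj[OF \<theta> csubspace_add[OF Vstar_subspace[OF \<theta>] pq(2) v2(1)]])
    have "\<sigma> * N x \<le> \<sigma> * N q" by (intro mult_left_mono xy) simp
    then have vq: "N v1 \<le> \<sigma> * N q" and zq: "N z \<le> \<sigma> * N q"
      using N_left_le[OF vz(1,2)] N_right_le[OF vz(1,2)] unfolding vz(3) by linarith+
    have scaled: "?t * N u \<le> A2 * s" if "N u \<le> \<sigma> * N q" for u
    proof -
      have "?t * N u \<le> ?t * (\<sigma> * N q)" using that by (intro mult_left_mono) auto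
      moreover have "\<sigma> * (?t * N q) \<le> \<sigma> * (D * s)" by (intro mult_left_mono pq) simp
      ultimately show ?thesis by (simp add: A2_def mult_ac)
    qed
    have dist: "nrm a b \<theta> (v1 - v2) \<le> R * (A2 * s)"
      using v2(2) mult_left_mono[OF scaled[OF vq] R(1)] by (simp add: mult_ac)
    have "N q \<le> K * nrm a b \<theta> w"
      using N_le_nrm[OF \<theta>, of q] mult_left_mono[OF pq(4) K_nonneg] by linarith
    then have "\<sigma> * N q \<le> \<sigma> * (K * nrm a b \<theta> w)" by (rule mult_left_mono) simp
    then have v1w: "N v1 \<le> \<sigma> * K * nrm a b \<theta> w" using vq by (simp add: mult_ac)
    \<comment> \<open>\<open>E \<theta>\<close> is an isometry, and p + v2 is rewritten so that only
      bounded quantities occur.\<close>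
    have "N v = nrm a b \<theta> (p + v1 - (v1 - v2))" using nrm_E[OF \<theta> v(1)] v(2) by simp
    also have "\<dots> \<le> nrm a b \<theta> p + nrm a b \<theta> v1 + nrm a b \<theta> (v1 - v2)"
      using nrm_triangle_diff[OF \<theta>, of "p + v1" "v1 - v2"] nrm_triangle[OF \<theta>, of p v1] by linarith
    also have "\<dots> \<le> nrm a b \<theta> w + K * N v1 + R * T * N v1"
    proof -
      have "R * ?t * N v1 \<le> R * T * N v1" using T[OF \<theta>] R(1) by (intro mult_right_mono mult_left_mono) auto
      then show ?thesis using pq(3) nrm_le_N[OF \<theta>, of v1] v2(2) by linarith
    qed
    also have "\<dots> = nrm a b \<theta> w + (K + R * T) * N v1" by (simp add: algebra_simps)
    also have "\<dots> \<le> nrm a b \<theta> w + (K + R * T) * (\<sigma> * K * nrm a b \<theta> w)"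
      using R(1) T_nonneg by (intro add_left_mono mult_left_mono v1w) auto
    also have "\<dots> = A1 * nrm a b \<theta> w" by (simp add: A1_def algebra_simps)
    finally have v_le: "N v \<le> A1 * nrm a b \<theta> w" .
    have "N y \<le> C1 * s"
      using C1(2)[OF \<theta> xy(2,3)] xy(4,5) pq(5,6) unfolding xy(1) by simp
    moreover have "N (v1 - v2) \<le> K * (R * (A2 * s))"
      using N_le_nrm[OF \<theta>, of "v1 - v2"] mult_left_mono[OF dist K_nonneg] by linarith
    ultimately have r_le: "N (y + (v1 - v2)) \<le> A3 * s"
      using N_triangle[of y "v1 - v2"] by (simp add: A3_def algebra_simps)
    have "A1 * nrm a b \<theta> w \<le> (A1 + A2 + A3) * nrm a b \<theta> w" "A2 * s \<le> (A1 + A2 + A3) * s"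
      "A3 * s \<le> (A1 + A2 + A3) * s"
      using A w0 s0 by (auto intro!: mult_right_mono)
    moreover have "w = E \<theta> v + z + (y + (v1 - v2))"
      using pq(1) xy(1) vz(3) v(2)[symmetric] by simp
    moreover note v_le scaled[OF zq] r_le
    ultimately show "\<exists>v\<in>Vs. \<exists>z\<in>Z. \<exists>r. w = E \<theta> v + z + r \<and> N v \<le> (A1 + A2 + A3) * nrm a b \<theta> w \<and>
      ?t * N z \<le> (A1 + A2 + A3) * form_norm (a \<theta>) w \<and> N r \<le> (A1 + A2 + A3) * form_norm (a \<theta>) w"
      unfolding s_def
      by (intro bexI[OF _ v(1)] bexI[OF _ vz(2)] exI[of _ "y + (v1 - v2)"] conjI) linarith+
  qed
qed

text \<open>Inserting the homogenised equation and the isometry of \<open>E \<theta>\<close> cancels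
  the leading terms and leaves nine remainders. Those with \<open>z'\<close> or r are bounded by the
  seminorm of w; the two where only \<open>v'\<close> or all of w is available use |\<theta>| N z =
  O(\<epsilon> F) and give the part \<epsilon> times the norm of w.\<close>

lemma residual_bound:
  assumes C1: "0 \<le> C1" and C2: "0 \<le> C2" and \<theta>: "\<theta> \<in> \<Theta>" and \<epsilon>: "0 < \<epsilon>"
    and f: "antidual f" and F: "0 \<le> F" "\<And>u. norm (f u) \<le> F * nrm a b \<theta> u"
    and sol: "solves_hom a b a' a'' Vs Z E f \<theta> \<epsilon> v z"
    and est: "N v \<le> C1 * F" "N z \<le> C1 * F" "norm \<theta> * N z \<le> C1 * \<epsilon> * F"
      "(norm \<theta>)\<^sup>2 * N z \<le> C1 * \<epsilon>\<^sup>2 * F"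
    and w: "v' \<in> Vs" "z' \<in> Z" "w = E \<theta> v' + z' + r" "N v' \<le> C2 * nrm a b \<theta> w"
      "norm \<theta> * N z' \<le> C2 * form_norm (a \<theta>) w" "N r \<le> C2 * form_norm (a \<theta>) w"
  defines "y \<equiv> z + corr \<theta> z"
  shows "norm (f w - (of_real (1 / \<epsilon>\<^sup>2) * a \<theta> (E \<theta> v + y) w + b \<theta> (E \<theta> v + y) w))
    \<le> (C1 * C2 * (Ch + Cm + 2 * Kb + Lb * K + K + K\<^sup>2) + K * Cn * C1 + K * C2)
      * (F * (form_norm (a \<theta>) w + \<epsilon> * nrm a b \<theta> w))"
proof -
  let ?t = "norm \<theta>" and ?h = "complex_of_real (1 / \<epsilon>\<^sup>2)" and ?n = "nrm a b \<theta> w"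
  define s where "s = form_norm (a \<theta>) w"
  have s0: "0 \<le> s" unfolding s_def by (rule form_norm_ge_zero[OF nonneg(1)[OF \<theta>]])
  have n0: "0 \<le> ?n" by (rule nrm_nonneg[OF \<theta>])
  note w = w(1-3) w(4-6)[folded s_def]
  have v: "v \<in> Vs" and z: "z \<in> Z"
    and eq: "hom ((1 / \<epsilon>) *\<^sub>R \<theta>) z z' + b 0 (v + z) (v' + z') = f (E \<theta> v' + z')"
    using sol w(1,2) unfolding solves_hom_def by auto
  have zV: "z \<in> V0" "z' \<in> V0" using Z_subset z w(2) by auto
  have f_add: "f (x + x') = f x + f x'" for x x' using f by (auto simp: antidual_def)
  have hom_eq: "hom ((1 / \<epsilon>) *\<^sub>R \<theta>) z z' = ?h * hom \<theta> z z'"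
    unfolding hom_scaleR_arg[OF zV] by (simp add: power_divide)
  have a_w: "a \<theta> (E \<theta> v + y) w = a \<theta> y z' + a \<theta> y r"
    unfolding w(3) by (simp add: a_simps \<theta> a_E_left[OF \<theta> v] a_E_right[OF \<theta> w(1)])
  have f_w: "f w = ?h * hom \<theta> z z' + b 0 v v' + b 0 v z' + b 0 z v' + b 0 z z' + f r"
    unfolding w(3) f_add[of _ r] eq[symmetric] hom_eq by (simp add: b0_simps)
  have b_w: "b \<theta> (E \<theta> v + y) w = b 0 v v' + b \<theta> (E \<theta> v) z' + b \<theta> (E \<theta> v) r
      + b \<theta> z (E \<theta> v') + b \<theta> z z' + b \<theta> z r + b \<theta> (corr \<theta> z) w"
  proof -
    have "b \<theta> (E \<theta> v + y) w = b \<theta> (E \<theta> v + z) w + b \<theta> (corr \<theta> z) w"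
      unfolding y_def by (simp add: b_simps \<theta>)
    moreover have "b \<theta> (E \<theta> v + z) w = b 0 v v' + b \<theta> (E \<theta> v) z' + b \<theta> (E \<theta> v) r
      + b \<theta> z (E \<theta> v') + b \<theta> z z' + b \<theta> z r"
      unfolding w(3) by (simp add: b_simps \<theta> E_iso[OF \<theta> v w(1)])
    ultimately show ?thesis by simp
  qed
  \<comment> \<open>\<open>r1\<close> and \<open>r2\<close> are consistency errors of
    \<open>a\<close>, \<open>r3\<close> to \<open>r5\<close> of \<open>b\<close>; \<open>r6\<close>
    is the corrector in \<open>b\<close>, and \<open>r7\<close> to \<open>r9\<close> come from the
    remainder r of the test vector.\<close>
  define r1 where "r1 = - (?h * (a \<theta> y z' - hom \<theta> z z'))"
  define r2 where "r2 = - (?h * a \<theta> y r)"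
  define r3 where "r3 = - cnj (b \<theta> (E \<theta> v') z - b 0 v' z)"
  define r4 where "r4 = - (b \<theta> (E \<theta> v) z' - b 0 v z')"
  define r5 where "r5 = - (b \<theta> z z' - b 0 z z')"
  define r6 where "r6 = - b \<theta> (corr \<theta> z) w"
  define r7 where "r7 = f r"
  define r8 where "r8 = - b \<theta> (E \<theta> v) r"
  define r9 where "r9 = - b \<theta> z r"
  have r3_eq: "r3 = b 0 z v' - b \<theta> z (E \<theta> v')"
    using form_herm[OF nonneg(2)[OF \<theta>], of z "E \<theta> v'"] form_herm[OF nonneg(2)[OF zero_mem], of z v']
    by (simp add: r3_def)
  have total: "f w - (?h * a \<theta> (E \<theta> v + y) w + b \<theta> (E \<theta> v + y) w)
    = r1 + r2 + r3 + r4 + r5 + r6 + r7 + r8 + r9"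
    unfolding a_w b_w f_w r1_def r2_def r3_eq r4_def r5_def r6_def r7_def r8_def r9_def
    by (simp add: algebra_simps)
  have nh: "norm ?h = 1 / \<epsilon>\<^sup>2" by (simp only: norm_of_real) simp
  \<comment> \<open>This bound compensates the singular factor in \<open>r1\<close> and
    \<open>r2\<close>.\<close>
  have tz2: "1 / \<epsilon>\<^sup>2 * (?t\<^sup>2 * N z) \<le> C1 * F"
    using est(4) \<epsilon> by (simp add: field_simps)
  have nr: "nrm a b \<theta> r \<le> K * (C2 * s)"
    using nrm_le_N[OF \<theta>, of r] mult_left_mono[OF w(6) K_nonneg] by linarith
  have F1: "0 \<le> C1 * F" using C1 F(1) by simp
  have C2s: "0 \<le> C2 * s" using C2 s0 by simp
  have b1: "norm r1 \<le> Ch * ((C1 * F) * (C2 * s))"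
  proof -
    have "norm r1 \<le> 1 / \<epsilon>\<^sup>2 * (Ch * ?t^3 * N z * N z')"
      unfolding r1_def norm_minus_cancel norm_mult nh y_def
      by (intro mult_left_mono hom_approx \<theta> zV) simp
    also have "\<dots> = Ch * ((1 / \<epsilon>\<^sup>2 * (?t\<^sup>2 * N z)) * (?t * N z'))"
      by (simp add: power2_eq_square power3_eq_cube)
    also have "\<dots> \<le> Ch * ((C1 * F) * (C2 * s))"
      by (intro mult_left_mono mult_mono tz2 w F1) simp_all
    finally show ?thesis .
  qed
  have b2: "norm r2 \<le> Cm * ((C1 * F) * (C2 * s))"
  proof -
    have "norm r2 \<le> 1 / \<epsilon>\<^sup>2 * (Cm * ?t\<^sup>2 * N z * N r)"
      unfolding r2_def norm_minus_cancel norm_mult nh y_def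
      by (intro mult_left_mono a_corrected_bound \<theta> zV) simp
    also have "\<dots> = Cm * ((1 / \<epsilon>\<^sup>2 * (?t\<^sup>2 * N z)) * N r)" by simp
    also have "\<dots> \<le> Cm * ((C1 * F) * (C2 * s))"
      by (intro mult_left_mono mult_mono tz2 w F1) simp_all
    finally show ?thesis .
  qed
  have b3: "norm r3 \<le> Kb * ((C1 * \<epsilon> * F) * (C2 * ?n))"
  proof -
    have "norm r3 \<le> Kb * ?t * N v' * N z"
      unfolding r3_def norm_minus_cancel complex_mod_cnj by (rule Kb(2)[OF \<theta> w(1) z])
    also have "\<dots> = Kb * ((?t * N z) * N v')" by simp
    also have "\<dots> \<le> Kb * ((C1 * \<epsilon> * F) * (C2 * ?n))"
      using C1 \<epsilon> F(1) Kb(1) by (intro mult_left_mono mult_mono est w) simp_all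
    finally show ?thesis .
  qed
  have b4: "norm r4 \<le> Kb * ((C1 * F) * (C2 * s))"
  proof -
    have "norm r4 \<le> Kb * ?t * N v * N z'"
      unfolding r4_def norm_minus_cancel by (rule Kb(2)[OF \<theta> v w(2)])
    also have "\<dots> = Kb * (N v * (?t * N z'))" by simp
    also have "\<dots> \<le> Kb * ((C1 * F) * (C2 * s))"
      using Kb(1) by (intro mult_left_mono mult_mono est w F1) simp_all
    finally show ?thesis .
  qed
  have b5: "norm r5 \<le> Lb * K * ((C1 * F) * (C2 * s))"
  proof -
    have "norm r5 \<le> Lb * ?t * N z * nrm a b \<theta> z'"
      unfolding r5_def norm_minus_cancel by (rule Lb(2)[OF zV \<theta>])
    also have "\<dots> \<le> Lb * ?t * N z * (K * N z')"
      using Lb(1) by (intro mult_left_mono nrm_le_N \<theta>) simp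
    also have "\<dots> = Lb * K * (N z * (?t * N z'))" by simp
    also have "\<dots> \<le> Lb * K * ((C1 * F) * (C2 * s))"
      using Lb(1) by (intro mult_left_mono mult_mono est w F1) simp_all
    finally show ?thesis .
  qed
  have b6: "norm r6 \<le> K * Cn * ((C1 * \<epsilon> * F) * ?n)"
  proof -
    have "norm r6 \<le> nrm a b \<theta> (corr \<theta> z) * ?n"
      unfolding r6_def norm_minus_cancel by (rule b_bound_nrm[OF \<theta>])
    also have "nrm a b \<theta> (corr \<theta> z) \<le> K * (Cn * ?t * N z)"
      using nrm_le_N[OF \<theta>, of "corr \<theta> z"] mult_left_mono[OF corr_bound[OF zV(1), of \<theta>] K_nonneg]
      by linarith
    also have "\<dots> = K * Cn * (?t * N z)" by simp
    also have "\<dots> \<le> K * Cn * (C1 * \<epsilon> * F)" by (intro mult_left_mono est) simp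
    finally show ?thesis using n0 by (simp add: mult_right_mono mult.assoc)
  qed
  have b7: "norm r7 \<le> K * (F * (C2 * s))"
    using F(2)[of r] mult_left_mono[OF nr F(1)] by (simp add: r7_def mult_ac)
  have b8: "norm r8 \<le> K * ((C1 * F) * (C2 * s))"
  proof -
    have "norm r8 \<le> N v * nrm a b \<theta> r"
      unfolding r8_def norm_minus_cancel nrm_E[OF \<theta> v, symmetric] by (rule b_bound_nrm[OF \<theta>])
    also have "\<dots> \<le> (C1 * F) * (K * (C2 * s))"
      by (intro mult_mono est nr F1 nrm_nonneg \<theta>)
    finally show ?thesis by (simp add: mult_ac)
  qed
  have b9: "norm r9 \<le> K\<^sup>2 * ((C1 * F) * (C2 * s))"
  proof -
    have "norm r9 \<le> nrm a b \<theta> z * nrm a b \<theta> r"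
      unfolding r9_def norm_minus_cancel by (rule b_bound_nrm[OF \<theta>])
    also have "\<dots> \<le> (K * (C1 * F)) * (K * (C2 * s))"
    proof (rule mult_mono[OF _ nr])
      show "nrm a b \<theta> z \<le> K * (C1 * F)"
        using nrm_le_N[OF \<theta>, of z] mult_left_mono[OF est(2) K_nonneg] by linarith
      show "0 \<le> K * (C1 * F)" using F1 by simp
    qed (rule nrm_nonneg[OF \<theta>])
    finally show ?thesis by (simp add: power2_eq_square mult_ac)
  qed
  have "norm (r1 + r2 + r3 + r4 + r5 + r6 + r7 + r8 + r9)
    \<le> norm r1 + norm r2 + norm r3 + norm r4 + norm r5 + norm r6 + norm r7 + norm r8 + norm r9"
    by (intro norm_triangle_le add_right_mono order_refl)
  also have "\<dots> \<le> (C1 * C2 * (Ch + Cm + Kb + Lb * K + K + K\<^sup>2) + K * C2) * (F * s)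
      + (C1 * C2 * Kb + K * Cn * C1) * (F * (\<epsilon> * ?n))"
    using b1 b2 b3 b4 b5 b6 b7 b8 b9 by (simp add: algebra_simps)
  \<comment> \<open>Both coefficients are enlarged to their sum so that one constant can be factored
    out.\<close>
  also have "\<dots> \<le> (C1 * C2 * (Ch + Cm + 2 * Kb + Lb * K + K + K\<^sup>2) + K * Cn * C1 + K * C2) * (F * s)
      + (C1 * C2 * (Ch + Cm + 2 * Kb + Lb * K + K + K\<^sup>2) + K * Cn * C1 + K * C2) * (F * (\<epsilon> * ?n))"
  proof (rule add_mono; rule mult_right_mono)
    have pos: "0 \<le> C1 * C2" "0 \<le> K * Cn * C1" "0 \<le> K * C2" "0 \<le> Kb" "0 \<le> Lb * K"
      using C1 C2 Kb(1) Lb(1) by simp_all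
    have "C1 * C2 * (Ch + Cm + Kb + Lb * K + K + K\<^sup>2) \<le> C1 * C2 * (Ch + Cm + 2 * Kb + Lb * K + K + K\<^sup>2)"
      using pos by (intro mult_left_mono) auto
    then show "C1 * C2 * (Ch + Cm + Kb + Lb * K + K + K\<^sup>2) + K * C2
      \<le> C1 * C2 * (Ch + Cm + 2 * Kb + Lb * K + K + K\<^sup>2) + K * Cn * C1 + K * C2"
      using pos by linarith
    have "C1 * C2 * Kb \<le> C1 * C2 * (Ch + Cm + 2 * Kb + Lb * K + K + K\<^sup>2)"
      using pos Ch_nonneg Cm_nonneg K_nonneg zero_le_power2[of K] by (intro mult_left_mono) linarith+
    then show "C1 * C2 * Kb + K * Cn * C1
      \<le> C1 * C2 * (Ch + Cm + 2 * Kb + Lb * K + K + K\<^sup>2) + K * Cn * C1 + K * C2"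
      using pos by linarith
  qed (use F(1) s0 n0 \<epsilon> in simp_all)
  finally show ?thesis
    unfolding total by (simp add: s_def distrib_left)
qed

text \<open>The energy A of the error equals the residual tested with the error. The seminorm of the
  error is at most \<epsilon> sqrt A by the weight, and its norm at most sqrt A because \<epsilon> <
  1, so the residual bound reads A \<le> 2 C \<epsilon> F sqrt A and one factor sqrt A
  cancels.\<close>

lemma error_estimate:
  obtains C9 C10 :: real where
    "\<And>f \<theta> \<epsilon> u v z. antidual f \<Longrightarrow> \<theta> \<in> \<Theta> \<Longrightarrow> 0 < \<epsilon> \<Longrightarrow> \<epsilon> < 1 \<Longrightarrow> solves_full a b f \<theta> \<epsilon> u \<Longrightarrow>
      solves_hom a b a' a'' Vs Z E f \<theta> \<epsilon> v z \<Longrightarrow>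
      1 / \<epsilon>\<^sup>2 * quad (a \<theta>) (u - (E \<theta> v + (z + corr \<theta> z))) + quad (b \<theta>) (u - (E \<theta> v + (z + corr \<theta> z)))
        \<le> C9 * \<epsilon>\<^sup>2 * (dual_nrm a b \<theta> f)\<^sup>2 \<and>
      quad (b \<theta>) (u - (E \<theta> v + z)) \<le> C10 * \<epsilon>\<^sup>2 * (dual_nrm a b \<theta> f)\<^sup>2"
proof -
  obtain C1 where C1: "0 \<le> C1"
    "\<And>\<theta> \<epsilon> F f v z. \<theta> \<in> \<Theta> \<Longrightarrow> 0 < \<epsilon> \<Longrightarrow> 0 \<le> F \<Longrightarrow> (\<And>u. norm (f u) \<le> F * nrm a b \<theta> u) \<Longrightarrow>
      solves_hom a b a' a'' Vs Z E f \<theta> \<epsilon> v z \<Longrightarrow>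
      N v \<le> C1 * F \<and> N z \<le> C1 * F \<and> norm \<theta> * N z \<le> C1 * \<epsilon> * F \<and> (norm \<theta>)\<^sup>2 * N z \<le> C1 * \<epsilon>\<^sup>2 * F"
    using hom_estimates by metis
  obtain C2 where C2: "0 \<le> C2"
    "\<And>\<theta> w. \<theta> \<in> \<Theta> \<Longrightarrow> \<exists>v\<in>Vs. \<exists>z\<in>Z. \<exists>r. w = E \<theta> v + z + r \<and> N v \<le> C2 * nrm a b \<theta> w \<and>
      norm \<theta> * N z \<le> C2 * form_norm (a \<theta>) w \<and> N r \<le> C2 * form_norm (a \<theta>) w"
    using test_decomposition by metis
  define C where "C = C1 * C2 * (Ch + Cm + 2 * Kb + Lb * K + K + K\<^sup>2) + K * Cn * C1 + K * C2"
  have C: "0 \<le> C" using C1(1) C2(1) Kb(1) Lb(1) by (simp add: C_def)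
  show ?thesis
  proof (rule that[of "(2 * C)\<^sup>2" "(2 * C + K * Cn * C1)\<^sup>2"], rule conjI)
    fix f \<theta> \<epsilon> u v z
    assume f: "antidual f" and \<theta>: "\<theta> \<in> \<Theta>" and \<epsilon>: "0 < \<epsilon>" "\<epsilon> < 1"
      and full: "solves_full a b f \<theta> \<epsilon> u" and sol: "solves_hom a b a' a'' Vs Z E f \<theta> \<epsilon> v z"
    define F where "F = \<bar>dual_nrm a b \<theta> f\<bar>"
    have F: "0 \<le> F" "\<And>x. norm (f x) \<le> F * nrm a b \<theta> x"
      using dual_bound[OF f \<theta>] by (auto simp: F_def)
    have F2: "(dual_nrm a b \<theta> f)\<^sup>2 = F\<^sup>2" by (simp add: F_def)
    let ?app = "E \<theta> v + (z + corr \<theta> z)"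
    define e where "e = u - ?app"
    define A where "A = 1 / \<epsilon>\<^sup>2 * quad (a \<theta>) e + quad (b \<theta>) e"
    have qa: "0 \<le> quad (a \<theta>) e" and qb: "0 \<le> quad (b \<theta>) e"
      using form_diag(2) nonneg \<theta> by auto
    have h1: "1 \<le> 1 / \<epsilon>\<^sup>2" using \<epsilon> by (simp add: power_le_one)
    have A0: "0 \<le> A" using qa qb by (simp add: A_def)
    have est: "N v \<le> C1 * F" "N z \<le> C1 * F" "norm \<theta> * N z \<le> C1 * \<epsilon> * F"
      "(norm \<theta>)\<^sup>2 * N z \<le> C1 * \<epsilon>\<^sup>2 * F"
      using C1(2)[OF \<theta> \<epsilon>(1) F sol] by auto
    obtain v' z' r where w: "v' \<in> Vs" "z' \<in> Z" "e = E \<theta> v' + z' + r" "N v' \<le> C2 * nrm a b \<theta> e"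
      "norm \<theta> * N z' \<le> C2 * form_norm (a \<theta>) e" "N r \<le> C2 * form_norm (a \<theta>) e"
      using C2(2)[OF \<theta>, of e] by blast
    have "complex_of_real (1 / \<epsilon>\<^sup>2) * a \<theta> e e + b \<theta> e e
      = f e - (complex_of_real (1 / \<epsilon>\<^sup>2) * a \<theta> ?app e + b \<theta> ?app e)"
    proof -
      have "complex_of_real (1 / \<epsilon>\<^sup>2) * a \<theta> u e + b \<theta> u e = f e"
        using full unfolding solves_full_def by blast
      moreover have "a \<theta> e e = a \<theta> u e - a \<theta> ?app e" "b \<theta> e e = b \<theta> u e - b \<theta> ?app e"
        using form_diff_left[OF nonneg(1)[OF \<theta>], of u ?app e]
          form_diff_left[OF nonneg(2)[OF \<theta>], of u ?app e] by (simp_all flip: e_def)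
      ultimately show ?thesis by (simp only: right_diff_distrib) simp
    qed
    moreover have "complex_of_real (1 / \<epsilon>\<^sup>2) * a \<theta> e e + b \<theta> e e = of_real A"
      unfolding form_diag(1)[OF nonneg(1)[OF \<theta>]] form_diag(1)[OF nonneg(2)[OF \<theta>]] A_def by simp
    moreover have "norm (complex_of_real A) = A" using A0 by simp
    ultimately have "A \<le> C * (F * (form_norm (a \<theta>) e + \<epsilon> * nrm a b \<theta> e))"
      using residual_bound[OF C1(1) C2(1) \<theta> \<epsilon>(1) f F sol est w] unfolding C_def by metis
    also have "\<dots> \<le> C * (F * (\<epsilon> * sqrt A + \<epsilon> * sqrt A))"
    proof (intro mult_left_mono add_mono C F(1))
      have "(form_norm (a \<theta>) e)\<^sup>2 \<le> (\<epsilon> * sqrt A)\<^sup>2"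
        using A0 qb \<epsilon> by (simp add: form_norm_square nonneg \<theta> power_mult_distrib A_def distrib_left)
      then show "form_norm (a \<theta>) e \<le> \<epsilon> * sqrt A"
        by (rule power2_le_imp_le) (use \<epsilon> A0 in simp)
      have "quad (a \<theta>) e \<le> 1 / \<epsilon>\<^sup>2 * quad (a \<theta>) e" using mult_right_mono[OF h1 qa] by simp
      then have "(nrm a b \<theta> e)\<^sup>2 \<le> (sqrt A)\<^sup>2"
        using A0 by (simp add: nrm_square[OF \<theta>] A_def)
      then show "nrm a b \<theta> e \<le> sqrt A" by (rule power2_le_imp_le) (use A0 in simp)
    qed (use \<epsilon> in simp)
    finally have "sqrt A * sqrt A \<le> 2 * C * \<epsilon> * F * sqrt A" using A0 by (simp add: mult_ac)
    then have sqrtA: "sqrt A \<le> 2 * C * \<epsilon> * F"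
      by (cases "A = 0")
        (use C \<epsilon> F(1) A0 mult_right_le_imp_le[of "sqrt A" "sqrt A" "2 * C * \<epsilon> * F"] in simp_all)
    then have "A \<le> (2 * C * \<epsilon> * F)\<^sup>2"
      using power_mono[OF sqrtA, of 2] A0 by simp
    then show "1 / \<epsilon>\<^sup>2 * quad (a \<theta>) (u - ?app) + quad (b \<theta>) (u - ?app)
      \<le> (2 * C)\<^sup>2 * \<epsilon>\<^sup>2 * (dual_nrm a b \<theta> f)\<^sup>2"
      unfolding F2 by (simp add: A_def e_def power_mult_distrib)
    have z: "z \<in> V0" using sol Z_subset by (auto simp: solves_hom_def)
    have "form_norm (b \<theta>) e \<le> sqrt A"
      unfolding form_norm_def using qa by (simp add: A_def)
    moreover have "form_norm (b \<theta>) (corr \<theta> z) \<le> K * Cn * C1 * \<epsilon> * F"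
    proof -
      have "form_norm (b \<theta>) (corr \<theta> z) \<le> K * N (corr \<theta> z)"
        using b_norm_le[OF \<theta>] nrm_le_N[OF \<theta>] order_trans by blast
      also have "\<dots> \<le> K * (Cn * norm \<theta> * N z)" by (intro mult_left_mono corr_bound z) simp
      also have "\<dots> = K * Cn * (norm \<theta> * N z)" by simp
      also have "\<dots> \<le> K * Cn * (C1 * \<epsilon> * F)" by (intro mult_left_mono est) simp
      finally show ?thesis by (simp add: mult_ac)
    qed
    \<comment> \<open>In the \<open>b\<close> seminorm the corrector may be dropped, being itself
      O(\<epsilon> F); its bound accounts for the summand added to 2 C.\<close>
    moreover have "u - (E \<theta> v + z) = e + corr \<theta> z" by (simp add: e_def)
    ultimately have "form_norm (b \<theta>) (u - (E \<theta> v + z)) \<le> (2 * C + K * Cn * C1) * \<epsilon> * F"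
      using form_norm_triangle[OF nonneg(2)[OF \<theta>], of e "corr \<theta> z"] sqrtA by (simp add: algebra_simps)
    then have "(form_norm (b \<theta>) (u - (E \<theta> v + z)))\<^sup>2 \<le> ((2 * C + K * Cn * C1) * \<epsilon> * F)\<^sup>2"
      by (intro power_mono form_norm_ge_zero nonneg \<theta>)
    then show "quad (b \<theta>) (u - (E \<theta> v + z)) \<le> (2 * C + K * Cn * C1)\<^sup>2 * \<epsilon>\<^sup>2 * (dual_nrm a b \<theta> f)\<^sup>2"
      unfolding F2 form_norm_square[OF nonneg(2)[OF \<theta>]] by (simp add: power_mult_distrib)
  qed
qed

end

theorem theorem5p9:
  fixes \<Theta> :: "(real ^ 'n::finite) set"
    and a b :: "real ^ 'n \<Rightarrow> 'h::chilbert_space \<Rightarrow> 'h \<Rightarrow> complex"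
    and a' :: "'h \<Rightarrow> 'h \<Rightarrow> complex ^ 'n"
    and a'' :: "'h \<Rightarrow> 'h \<Rightarrow> complex ^ 'n ^ 'n"
    and Vs Z :: "'h set"
    and E :: "real ^ 'n \<Rightarrow> 'h \<Rightarrow> 'h"
  assumes separable: "\<exists>D::'h set. countable D \<and> closure D = UNIV"
    and "standing \<Theta> a b"
    and "spectral_gap \<Theta> a b"
    and "removable_singularity \<Theta> a b Vs"
    and "complement a b Vs Z"
    and "quadratic_degeneracy \<Theta> a b"
    and "a_regularity \<Theta> a b a' a''"
    and "b_regularity \<Theta> a b"
    and "transfer_ops \<Theta> a b Vs Z E"
  shows "(\<forall>f \<theta> \<epsilon>. antidual f \<and> \<theta> \<in> \<Theta> \<and> 0 < \<epsilon> \<and> \<epsilon> < 1 \<longrightarrow>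
            (\<exists>!(v, z). solves_hom a b a' a'' Vs Z E f \<theta> \<epsilon> v z)) \<and>
         (\<exists>C9 C10 :: real. \<forall>f \<theta> \<epsilon> u v z.
            antidual f \<and> \<theta> \<in> \<Theta> \<and> 0 < \<epsilon> \<and> \<epsilon> < 1 \<and> solves_full a b f \<theta> \<epsilon> u \<and>
            solves_hom a b a' a'' Vs Z E f \<theta> \<epsilon> v z \<longrightarrow>
              1 / \<epsilon>\<^sup>2 * quad (a \<theta>) (u - (E \<theta> v + (z + corrector a b a' \<theta> z)))
                + quad (b \<theta>) (u - (E \<theta> v + (z + corrector a b a' \<theta> z)))
                \<le> C9 * \<epsilon>\<^sup>2 * (dual_nrm a b \<theta> f)\<^sup>2 \<and>
              quad (b \<theta>) (u - (E \<theta> v + z)) \<le> C10 * \<epsilon>\<^sup>2 * (dual_nrm a b \<theta> f)\<^sup>2)"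
proof -
  note standing = assms(2)[unfolded standing_def]
  have nonneg: "nonneg_form (a \<theta>)" "nonneg_form (b \<theta>)" if "\<theta> \<in> \<Theta>" for \<theta>
    using standing that by blast+
  have zero: "0 \<in> \<Theta>" using standing interior_subset by blast
  have nrm_nonneg: "0 \<le> nrm a b \<theta> u" if "\<theta> \<in> \<Theta>" for \<theta> u
    using form_norm_ge_zero[OF nonneg_form_ip] nonneg[OF that] by (simp add: nrm_eq_form_norm)
  obtain \<rho> where \<rho>: "0 < \<rho>" "\<And>\<theta>. norm \<theta> \<le> \<rho> \<Longrightarrow> \<theta> \<in> \<Theta>"
  proof -
    obtain r where "0 < r" "cball 0 r \<subseteq> \<Theta>" using standing by (auto simp: mem_interior_cball)
    then show ?thesis using that[of r] by (auto simp: subset_iff)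
  qed
  obtain T where T: "\<And>\<theta>. \<theta> \<in> \<Theta> \<Longrightarrow> norm \<theta> \<le> T"
    using standing compact_imp_bounded bounded_iff by metis
  obtain c0 C0 where c0: "0 < c0" "\<And>u. c0 * norm u \<le> nrm a b 0 u"
    and C0: "0 < C0" "\<And>u. nrm a b 0 u \<le> C0 * norm u"
    using standing zero unfolding equivalent_inner_def nrm_def by metis
  obtain K0 where K0: "K0 > 0"
    "\<And>u \<theta>1 \<theta>2. \<theta>1 \<in> \<Theta> \<Longrightarrow> \<theta>2 \<in> \<Theta> \<Longrightarrow> nrm a b \<theta>1 u \<le> K0 * nrm a b \<theta>2 u"
    using standing by blast
  define K where "K = max 1 K0"
  have K: "1 \<le> K" "nrm a b \<theta>1 u \<le> K * nrm a b \<theta>2 u" if "\<theta>1 \<in> \<Theta>" "\<theta>2 \<in> \<Theta>" for u \<theta>1 \<theta>2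
    using K0(2)[OF that, of u] mult_right_mono[of K0 K "nrm a b \<theta>2 u"] nrm_nonneg[OF that(2)]
    by (auto simp: K_def intro: order_trans)
  obtain L where L: "L > 0" "\<And>u v \<theta>1 \<theta>2. \<theta>1 \<in> \<Theta> \<Longrightarrow> \<theta>2 \<in> \<Theta> \<Longrightarrow>
      norm (a \<theta>1 u v - a \<theta>2 u v) \<le> L * norm (\<theta>1 - \<theta>2) * nrm a b \<theta>1 u * nrm a b \<theta>1 v"
    using standing by blast
  have L0: "norm (a \<theta> u v - a 0 u v) \<le> L * norm \<theta> * nrm a b 0 u * nrm a b 0 v" if "\<theta> \<in> \<Theta>" for \<theta> u v
    using L(2)[OF zero that, of u v] by (simp add: norm_minus_commute)
  obtain \<nu> where \<nu>: "0 < \<nu>" "\<And>w. w \<in> W a b 0 \<Longrightarrow> \<nu> * (nrm a b 0 w)\<^sup>2 \<le> quad (a 0) w"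
    using assms(3) zero unfolding spectral_gap_def by blast
  note rs = assms(4)[unfolded removable_singularity_def]
  have Vs: "csubspace Vs" using rs by blast
  obtain R where R: "0 \<le> R" "\<And>\<theta>1 \<theta>2 v1. \<theta>1 \<in> \<Theta> \<Longrightarrow> \<theta>2 \<in> \<Theta> \<Longrightarrow> v1 \<in> Vstar a Vs \<theta>1 \<Longrightarrow>
      (INF v2\<in>Vstar a Vs \<theta>2. nrm a b \<theta>2 (v1 - v2)) \<le> R * norm (\<theta>1 - \<theta>2) * nrm a b \<theta>1 v1"
    using rs by blast
  have zero_Vstar: "0 \<in> Vstar a Vs \<theta>" if "\<theta> \<in> \<Theta>" for \<theta>
    using csubspace_zero[OF Vs] form_zero_left[OF nonneg(1)[OF that]] by (simp add: Vstar_def V_def)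
  \<comment> \<open>The infimum need not be attained. Raising R to R + 1 gives a strict gap, hence
    an actual near point, unless the bound is zero; then \<open>v1\<close> itself (equal parameters)
    or 0 (vanishing norm) serves.\<close>
  have near: "\<exists>v2\<in>Vstar a Vs \<theta>2. nrm a b \<theta>2 (v1 - v2) \<le> (R + 1) * norm (\<theta>1 - \<theta>2) * nrm a b \<theta>1 v1"
    if \<theta>: "\<theta>1 \<in> \<Theta>" "\<theta>2 \<in> \<Theta>" and v1: "v1 \<in> Vstar a Vs \<theta>1" for \<theta>1 \<theta>2 v1
  proof -
    have null: "nrm a b \<theta> 0 = 0" if "\<theta> \<in> \<Theta>" for \<theta>
      using form_norm_zero[OF nonneg_form_ip] nonneg[OF that] by (simp add: nrm_eq_form_norm)
    consider "\<theta>1 = \<theta>2" | "nrm a b \<theta>1 v1 = 0" | "0 < norm (\<theta>1 - \<theta>2) * nrm a b \<theta>1 v1"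
      using nrm_nonneg[OF \<theta>(1), of v1] by (cases "\<theta>1 = \<theta>2") (auto simp: order_less_le)
    then show ?thesis
    proof cases
      case 1
      then show ?thesis using v1 null[OF \<theta>(2)] by (intro bexI[of _ v1]) auto
    next
      case 2
      have "nrm a b \<theta>2 v1 \<le> 0" using K(2)[OF \<theta>(2,1), of v1] 2 by simp
      then show ?thesis using 2 zero_Vstar[OF \<theta>(2)] by (intro bexI[of _ 0]) auto
    next
      case 3
      then have "R * norm (\<theta>1 - \<theta>2) * nrm a b \<theta>1 v1 < (R + 1) * norm (\<theta>1 - \<theta>2) * nrm a b \<theta>1 v1"
        by (simp add: algebra_simps)
      then have lt: "(INF v2\<in>Vstar a Vs \<theta>2. nrm a b \<theta>2 (v1 - v2)) < (R + 1) * norm (\<theta>1 - \<theta>2) * nrm a b \<theta>1 v1"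
        using R(2)[OF \<theta> v1] by linarith
      have ne: "(\<lambda>v2. nrm a b \<theta>2 (v1 - v2)) ` Vstar a Vs \<theta>2 \<noteq> {}"
        using zero_Vstar[OF \<theta>(2)] by blast
      show ?thesis using cInf_lessD[OF ne lt] by (auto intro: less_imp_le)
    qed
  qed
  note cpl = assms(5)[unfolded complement_def]
  obtain \<kappa> where \<kappa>: "0 \<le> \<kappa>" "\<kappa> < 1"
    "\<And>v z. v \<in> Vs \<Longrightarrow> z \<in> Z \<Longrightarrow> norm (ip a b 0 v z) \<le> \<kappa> * nrm a b 0 v * nrm a b 0 z"
    using cpl by blast
  obtain \<gamma> where \<gamma>: "0 < \<gamma>" "\<And>\<theta> w. \<theta> \<in> \<Theta> \<Longrightarrow> w \<in> W a b \<theta> \<Longrightarrow>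
      \<gamma> * (norm \<theta>)\<^sup>2 * (nrm a b \<theta> w)\<^sup>2 \<le> quad (a \<theta>) w"
    using assms(6) unfolding quadratic_degeneracy_def by blast
  note ar = assms(7)[unfolded a_regularity_def]
  obtain Ka where Ka: "0 \<le> Ka" "\<And>v u \<theta>. v \<in> V a 0 \<Longrightarrow> \<theta> \<in> \<Theta> \<Longrightarrow>
      norm (a \<theta> v u - cdot (a' v u) \<theta>) \<le> Ka * (norm \<theta>)\<^sup>2 * nrm a b 0 v * nrm a b 0 u"
    using ar by blast
  obtain Kq where Kq: "0 \<le> Kq" "\<And>v w \<theta>. v \<in> V a 0 \<Longrightarrow> w \<in> V a 0 \<Longrightarrow> \<theta> \<in> \<Theta> \<Longrightarrow>
      norm (a \<theta> v w - cquad (a'' v w) \<theta>) \<le> Kq * (norm \<theta>) ^ 3 * nrm a b 0 v * nrm a b 0 w"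
    using ar by blast
  obtain Lb where Lb: "0 \<le> Lb" "\<And>v w \<theta>. v \<in> V a 0 \<Longrightarrow> w \<in> V a 0 \<Longrightarrow> \<theta> \<in> \<Theta> \<Longrightarrow>
      norm (b \<theta> v w - b 0 v w) \<le> Lb * norm \<theta> * nrm a b 0 v * nrm a b \<theta> w"
    using assms(8) unfolding b_regularity_def by blast
  note tr = assms(9)[unfolded transfer_ops_def]
  obtain Kb where Kb: "0 \<le> Kb" "\<And>\<theta> v z. \<theta> \<in> \<Theta> \<Longrightarrow> v \<in> Vs \<Longrightarrow> z \<in> Z \<Longrightarrow>
      norm (b \<theta> (E \<theta> v) z - b 0 v z) \<le> Kb * norm \<theta> * nrm a b 0 v * nrm a b 0 z"
    using tr by blast
  interpret degenerate_family \<Theta> a b a' a'' Vs Z E \<rho> T c0 C0 K L \<nu> "R + 1" \<kappa> \<gamma> Ka Kq Lb Kb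
  proof
    show "1 \<le> K" by (simp add: K_def)
    show "0 \<le> L" using L by simp
    show "0 \<le> R + 1" using R by simp
    show "csubspace Z" "direct_sum (V a 0) Vs Z" using cpl by blast+
    show "sesquilinear_on (V a 0) UNIV (\<lambda>v u. a' v u $ i)" for i using ar by blast
    show "sesquilinear_on (V a 0) (V a 0) (\<lambda>v u. a'' v u $ i $ j)" for i j using ar by blast
    show "clinear_on Vs (E \<theta>)" "bij_betw (E \<theta>) Vs (Vstar a Vs \<theta>)" if "\<theta> \<in> \<Theta>" for \<theta>
      using tr that by blast+
    show "b \<theta> (E \<theta> v) (E \<theta> w) = b 0 v w" if "\<theta> \<in> \<Theta>" "v \<in> Vs" "w \<in> Vs" for \<theta> v w
      using tr that by blast
  qed (fact nonneg \<rho> T c0 C0 K L0 \<nu> Vs near \<kappa> \<gamma> Ka Kq Lb Kb)+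
  obtain C9 C10 :: real where
    "\<And>f \<theta> \<epsilon> u v z. antidual f \<Longrightarrow> \<theta> \<in> \<Theta> \<Longrightarrow> 0 < \<epsilon> \<Longrightarrow> \<epsilon> < 1 \<Longrightarrow> solves_full a b f \<theta> \<epsilon> u \<Longrightarrow>
      solves_hom a b a' a'' Vs Z E f \<theta> \<epsilon> v z \<Longrightarrow>
      1 / \<epsilon>\<^sup>2 * quad (a \<theta>) (u - (E \<theta> v + (z + corrector a b a' \<theta> z)))
          + quad (b \<theta>) (u - (E \<theta> v + (z + corrector a b a' \<theta> z)))
        \<le> C9 * \<epsilon>\<^sup>2 * (dual_nrm a b \<theta> f)\<^sup>2 \<and>
      quad (b \<theta>) (u - (E \<theta> v + z)) \<le> C10 * \<epsilon>\<^sup>2 * (dual_nrm a b \<theta> f)\<^sup>2"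
    using error_estimate by metis
  then show ?thesis
    using hom_solvable by blast
qed

end
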